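(* Let $I$ be a finite nonempty set of players, let $A_i$ be a finite nonempty set of actions for each $i\in I$, and let $A=\prod_{i\in I}A_i$. Let $(\sigma^*,D)$ be a goal, that is, $\sigma^*=(\sigma^*_i)_{i\in I}$ is a profile of behavior strategies and $D\subseteq A^{\mathbb{N}}$ is a Borel set, and let $\varepsilon$ be a real number such that $\mathbf{P}_{\sigma^*}(D)>1-\varepsilon$. Then $(\sigma^*,D)$ is $2\sqrt{(|I|-1)\varepsilon}$-testable.
   Context: $A^{<\mathbb{N}}$ is the set of finite sequences of elements of $A$ (including the empty sequence). A behavior strategy of player $i$ is a function $\sigma_i:A^{<\mathbb{N}}\to\Delta(A_i)$, where $\Delta(A_i)$ is the set of probability distributions on $A_i$; $\Sigma_i$ is the set of behavior strategies of player $i$. The space $A^{\mathbb{N}}$ carries the product topology (with $A$ discrete) and the Borel $\sigma$-algebra. A profile $\sigma=(\sigma_i)_{i\in I}\in\prod_i\Sigma_i$ induces a probability measure $\mathbf{P}_\sigma$ on $A^{\mathbb{N}}$: in each period $n$, given the action profiles $z^1,\dots,z^{n-1}$ chosen in the first $n-1$ periods, the players choose their actions independently, player $i$ according to $\sigma_i(\cdot\mid z^1,\dots,z^{n-1})$. $\mathbf{P}_{\sigma_i,\sigma^*_{-i}}$ denotes the measure induced when player $i$ uses $\sigma_i$ and every player $j\ne i$ uses $\sigma^*_j$. A blame function is a Borel function $f:D^c\to I$, where $D^c=A^{\mathbb{N}}\setminus D$. For $\delta\ge 0$, the goal $(\sigma^*,D)$ is $\delta$-testable if there exists a blame function $f$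 such that for every player $i\in I$ and every $\sigma_i\in\Sigma_i$, $\mathbf{P}_{\sigma_i,\sigma^*_{-i}}(\{s\in D^c: f(s)\ne i\})\le\delta$. *)

theory Defs
  imports "HOL-Probability.Probability"
begin

text \<open>
  The players are the elements of a finite type \<open>'i\<close>, and \<open>Act i\<close> is the action set of player \<open>i\<close>,
  a subset of a common type \<open>'a\<close>. Action profiles are functions \<open>'i \<Rightarrow> 'a\<close>, finite histories are
  lists of profiles in chronological order, and infinite plays are functions \<open>nat \<Rightarrow> 'i \<Rightarrow> 'a\<close>.
\<close>

definition profiles :: "('i \<Rightarrow> 'a set) \<Rightarrow> ('i \<Rightarrow> 'a) set" where
  "profiles Act = (\<Pi>\<^sub>E i\<in>UNIV. Act i)"

definition plays :: "('i \<Rightarrow> 'a set) \<Rightarrow> (nat \<Rightarrow> 'i \<Rightarrow> 'a) set" where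
  "plays Act = (\<Pi>\<^sub>E n\<in>UNIV. profiles Act)"

definition play_topology :: "('i \<Rightarrow> 'a set) \<Rightarrow> (nat \<Rightarrow> 'i \<Rightarrow> 'a) topology" where
  "play_topology Act = product_topology (\<lambda>_. discrete_topology (profiles Act)) UNIV"

text \<open>
  The \<open>\<sigma>\<close>-algebra generated by the open sets of the abstract topology above (the type-class
  constant \<open>borel\<close> is not applicable). Only the measurable sets matter; the measure is \<open>0\<close>.
\<close>

definition play_borel :: "('i \<Rightarrow> 'a set) \<Rightarrow> (nat \<Rightarrow> 'i \<Rightarrow> 'a) measure" where
  "play_borel Act = sigma (plays Act) {U. openin (play_topology Act) U}"

text \<open>
  A strategy is a function on all lists; only its values on lists of profiles from \<open>profiles Act\<close>
  are constrained, and only those enter the induced measure.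
\<close>

definition behavior_strategies ::
    "('i \<Rightarrow> 'a set) \<Rightarrow> 'i \<Rightarrow> (('i \<Rightarrow> 'a) list \<Rightarrow> 'a pmf) set" where
  "behavior_strategies Act i = {\<tau>. \<forall>h\<in>lists (profiles Act). set_pmf (\<tau> h) \<subseteq> Act i}"

text \<open>
  Independent choices of all players after history \<open>h\<close>. The default value \<open>undefined\<close> of
  \<open>Pi_pmf\<close> plays no role since the index set is all of \<open>UNIV\<close>.
\<close>

definition stage_pmf ::
    "('i::finite \<Rightarrow> ('i \<Rightarrow> 'a) list \<Rightarrow> 'a pmf) \<Rightarrow> ('i \<Rightarrow> 'a) list \<Rightarrow> ('i \<Rightarrow> 'a) pmf" where
  "stage_pmf \<sigma> h = Pi_pmf UNIV undefined (\<lambda>i. \<sigma> i h)"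

definition stage_kernel ::
    "('i::finite \<Rightarrow> 'a set) \<Rightarrow> ('i \<Rightarrow> ('i \<Rightarrow> 'a) list \<Rightarrow> 'a pmf)
      \<Rightarrow> nat \<Rightarrow> (nat \<Rightarrow> 'i \<Rightarrow> 'a) \<Rightarrow> ('i \<Rightarrow> 'a) measure" where
  "stage_kernel Act \<sigma> n \<omega> =
     restrict_space (measure_pmf (stage_pmf \<sigma> (map \<omega> [0..<n]))) (profiles Act)"

text \<open>
  The Ionescu-Tulcea measure of the stage kernels. The lemmas \<open>sets_play_measure\<close>,
  \<open>prob_space_play_measure\<close> and \<open>measure_play_measure_cylinder\<close> below show that, for a strategy
  profile, it is the probability measure on the Borel sets of plays with the expected probabilities
  of cylinders.
\<close>

definition play_measure ::
    "('i::finite \<Rightarrow> 'a set) \<Rightarrow> ('i \<Rightarrow> ('i \<Rightarrow> 'a) list \<Rightarrow> 'a pmf)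
      \<Rightarrow> (nat \<Rightarrow> 'i \<Rightarrow> 'a) measure" where
  "play_measure Act \<sigma> =
     (let M = (\<lambda>_. count_space (profiles Act))
      in projective_family.lim UNIV (Ionescu_Tulcea.CI (stage_kernel Act \<sigma>) M) M)"

definition goal ::
    "('i \<Rightarrow> 'a set) \<Rightarrow> ('i \<Rightarrow> ('i \<Rightarrow> 'a) list \<Rightarrow> 'a pmf) \<Rightarrow> (nat \<Rightarrow> 'i \<Rightarrow> 'a) set \<Rightarrow> bool" where
  "goal Act \<sigma> D \<longleftrightarrow> (\<forall>i. \<sigma> i \<in> behavior_strategies Act i) \<and> D \<in> sets (play_borel Act)"

definition blame_functions ::
    "('i \<Rightarrow> 'a set) \<Rightarrow> (nat \<Rightarrow> 'i \<Rightarrow> 'a) set \<Rightarrow> ((nat \<Rightarrow> 'i \<Rightarrow> 'a) \<Rightarrow> 'i) set" where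
  "blame_functions Act D =
     measurable (restrict_space (play_borel Act) (plays Act - D)) (count_space UNIV)"

definition testable ::
    "('i::finite \<Rightarrow> 'a set) \<Rightarrow> ('i \<Rightarrow> ('i \<Rightarrow> 'a) list \<Rightarrow> 'a pmf) \<Rightarrow> (nat \<Rightarrow> 'i \<Rightarrow> 'a) set
      \<Rightarrow> real \<Rightarrow> bool" where
  "testable Act \<sigma> D \<delta> \<longleftrightarrow>
     (\<exists>f\<in>blame_functions Act D. \<forall>i. \<forall>\<tau>\<in>behavior_strategies Act i.
        measure (play_measure Act (\<sigma>(i := \<tau>))) {s \<in> plays Act - D. f s \<noteq> i} \<le> \<delta>)"


lemma topspace_play_topology: "topspace (play_topology Act) = plays Act"
  by (simp add: play_topology_def plays_def)

lemma openin_play_topology_subset: "{U. openin (play_topology Act) U} \<subseteq> Pow (plays Act)"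
  using openin_subset[of "play_topology Act"] by (auto simp only: topspace_play_topology)

lemma space_play_borel: "space (play_borel Act) = plays Act"
  by (simp add: play_borel_def space_measure_of[OF openin_play_topology_subset])

lemma sets_play_borel: "sets (play_borel Act) = sigma_sets (plays Act) {U. openin (play_topology Act) U}"
  unfolding play_borel_def
  by (rule sets_measure_of[OF openin_play_topology_subset])

lemma finite_profiles:
  fixes Act :: "'i::finite \<Rightarrow> 'a set"
  shows "(\<And>i. finite (Act i)) \<Longrightarrow> finite (profiles Act)"
  unfolding profiles_def by (rule finite_PiE) auto

lemma sets_PiM_profiles:
  fixes Act :: "'i::finite \<Rightarrow> 'a set"
  assumes fin: "\<And>i. finite (Act i)"
  shows "sets (PiM UNIV (\<lambda>_::nat. count_space (profiles Act))) = sets (play_borel Act)"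
proof (rule antisym)
  let ?A = "profiles Act" and ?M = "\<lambda>_::nat. count_space (profiles Act)"
  have finA: "finite ?A" by (rule finite_profiles[OF fin])
  show "sets (PiM UNIV ?M) \<subseteq> sets (play_borel Act)"
    unfolding sets_PiM_single
  proof (rule sets.sigma_sets_subset'[of _ "play_borel Act"], safe)
    fix n :: nat and B assume B: "B \<in> sets (count_space ?A)"
    have "continuous_map (play_topology Act) (discrete_topology ?A) (\<lambda>f. f n)"
      unfolding play_topology_def by (rule continuous_map_product_projection) simp
    then have "openin (play_topology Act) {f \<in> topspace (play_topology Act). f n \<in> B}"
      using B by (auto intro: openin_continuous_map_preimage)
    then show "{f \<in> \<Pi>\<^sub>E i\<in>UNIV. space (?M i). f n \<in> B} \<in> sets (play_borel Act)"
      unfolding sets_play_borel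
      by (intro sigma_sets.Basic) (simp add: topspace_play_topology plays_def)
  next
    show "(\<Pi>\<^sub>E i\<in>UNIV. space (?M i)) \<in> sets (play_borel Act)"
      using sets.top[of "play_borel Act"] by (simp add: space_play_borel plays_def)
  qed
  show "sets (play_borel Act) \<subseteq> sets (PiM UNIV ?M)"
    unfolding sets_play_borel
  proof (rule sets.sigma_sets_subset')
    show "plays Act \<in> sets (PiM UNIV ?M)"
      using sets.top[of "PiM UNIV ?M"] by (simp add: space_PiM plays_def)
    show "{U. openin (play_topology Act) U} \<subseteq> sets (PiM UNIV ?M)"
    proof safe
      fix U assume U: "openin (play_topology Act) U"
      define cyl where "cyl l = {s \<in> plays Act. \<forall>k<length l. s k = l ! k}" for l
      have cyl_meas: "cyl l \<in> sets (PiM UNIV ?M)" for l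
      proof (cases "l \<in> lists ?A")
        case True
        have "cyl l = prod_emb UNIV ?M {0..<length l} (\<Pi>\<^sub>E k\<in>{0..<length l}. {l ! k})"
          using True by (auto simp: cyl_def prod_emb_def plays_def PiE_iff space_PiM)
        also have "\<dots> \<in> sets (PiM UNIV ?M)"
          using True by (intro sets_PiM_I) auto
        finally show ?thesis .
      next
        case False
        then have "cyl l = {}"
          by (auto simp: cyl_def plays_def PiE_iff in_set_conv_nth lists_eq_set) metis
        then show ?thesis by simp
      qed
      have "countable (lists ?A)"
        using finA by (simp add: countable_finite)
      then have "(\<Union>l\<in>{l\<in>lists ?A. cyl l \<subseteq> U}. cyl l) \<in> sets (PiM UNIV ?M)"
        using cyl_meas by (intro sets.countable_UN'') (auto intro: countable_subset)
      also have "(\<Union>l\<in>{l\<in>lists ?A. cyl l \<subseteq> U}. cyl l) = U"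
      proof safe
        fix s assume s: "s \<in> U"
        from U s have sp: "s \<in> plays Act"
          using openin_subset[OF U] by (auto simp: topspace_play_topology)
        from U s obtain X where X: "s \<in> PiE UNIV X" "finite {i. X i \<noteq> ?A}" "PiE UNIV X \<subseteq> U"
          unfolding play_topology_def
          using product_topology_open_contains_basis[of "\<lambda>_. discrete_topology ?A" UNIV U s] by auto
        define n where "n = Suc (Max ({i. X i \<noteq> ?A} \<union> {0}))"
        have n: "X i = ?A" if "i \<ge> n" for i
        proof (rule ccontr)
          assume "X i \<noteq> ?A"
          then have "i \<le> Max ({i. X i \<noteq> ?A} \<union> {0})" using X(2) by (intro Max_ge) auto
          with that show False by (simp add: n_def)
        qed
        let ?l = "map s [0..<n]"
        have "cyl ?l \<subseteq> PiE UNIV X"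
        proof
          fix t assume t: "t \<in> cyl ?l"
          have "t i \<in> X i" for i
          proof (cases "i < n")
            case True
            then have "t i = s i" using t by (simp add: cyl_def)
            then show ?thesis using X(1) by (auto simp: PiE_iff)
          next
            case False
            then show ?thesis using n[of i] t by (auto simp: cyl_def plays_def PiE_iff)
          qed
          then show "t \<in> PiE UNIV X" by auto
        qed
        moreover have "?l \<in> lists ?A" using sp by (auto simp: plays_def PiE_iff)
        moreover have "s \<in> cyl ?l" using sp by (simp add: cyl_def)
        moreover note X(3)
        ultimately show "s \<in> (\<Union>l\<in>{l\<in>lists ?A. cyl l \<subseteq> U}. cyl l)"
          by (intro UN_I[of ?l] CollectI conjI) simp_all
      qed auto
      finally show "U \<in> sets (PiM UNIV ?M)" .
    qed
  qed
qed

lemma stage_kernel_Ionescu_Tulcea: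
  fixes Act :: "'i::finite \<Rightarrow> 'a set"
  assumes fin: "\<And>i. finite (Act i)" and \<sigma>: "\<And>i. \<sigma> i \<in> behavior_strategies Act i"
  shows "Ionescu_Tulcea (stage_kernel Act \<sigma>) (\<lambda>_. count_space (profiles Act))"
proof -
  let ?A = "profiles Act"
  have finA: "finite ?A" by (rule finite_profiles[OF fin])
  have PiM_eq: "PiM {0..<n} (\<lambda>_. count_space ?A) = count_space (\<Pi>\<^sub>E k\<in>{0..<n}. ?A)" for n :: nat
    by (rule count_space_PiM_finite) (auto simp: finA countable_finite)
  have prob: "prob_space (stage_kernel Act \<sigma> n \<omega>)" if "\<omega> \<in> (\<Pi>\<^sub>E k\<in>{0..<n}. ?A)" for n \<omega>
    unfolding stage_kernel_def
  proof (rule prob_space_restrict_space)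
    have "map \<omega> [0..<n] \<in> lists ?A" using that by auto
    with \<sigma> have "set_pmf (\<sigma> i (map \<omega> [0..<n])) \<subseteq> Act i" for i
      unfolding behavior_strategies_def by blast
    then have "set_pmf (stage_pmf \<sigma> (map \<omega> [0..<n])) \<subseteq> ?A"
      by (auto simp: stage_pmf_def set_Pi_pmf PiE_dflt_def profiles_def)
    then show "emeasure (measure_pmf (stage_pmf \<sigma> (map \<omega> [0..<n]))) ?A = 1"
      by (simp add: measure_pmf.emeasure_eq_measure measure_pmf.prob_eq_1 AE_measure_pmf_iff subset_iff)
  qed simp
  have sets: "sets (stage_kernel Act \<sigma> n \<omega>) = sets (count_space ?A)" for n \<omega>
    by (auto simp: stage_kernel_def sets_restrict_space)
  show ?thesis
    unfolding Ionescu_Tulcea_def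
  proof (intro conjI allI impI)
    fix n :: nat
    show "stage_kernel Act \<sigma> n \<in> measurable (PiM {0..<n} (\<lambda>_. count_space ?A)) (subprob_algebra (count_space ?A))"
      unfolding PiM_eq
      by (auto simp: space_subprob_algebra sets intro!: prob_space_imp_subprob_space prob)
  next
    fix n :: nat and \<omega> :: "nat \<Rightarrow> 'i \<Rightarrow> 'a"
    assume "\<omega> \<in> space (PiM {0..<n} (\<lambda>_. count_space ?A))"
    then show "prob_space (stage_kernel Act \<sigma> n \<omega>)"
      unfolding PiM_eq by (intro prob) simp
  qed
qed

lemma sets_play_measure:
  fixes Act :: "'i::finite \<Rightarrow> 'a set"
  assumes fin: "\<And>i. finite (Act i)" and \<sigma>: "\<And>i. \<sigma> i \<in> behavior_strategies Act i"
  shows "sets (play_measure Act \<sigma>) = sets (play_borel Act)"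
proof -
  interpret Ionescu_Tulcea "stage_kernel Act \<sigma>" "\<lambda>_. count_space (profiles Act)"
    by (rule stage_kernel_Ionescu_Tulcea[OF fin \<sigma>])
  show ?thesis
    by (simp add: play_measure_def Let_def sets_PiM_profiles[OF fin, symmetric])
qed

lemma emeasure_play_measure_cylinder:
  fixes Act :: "'i::finite \<Rightarrow> 'a set"
  assumes fin: "\<And>i. finite (Act i)" and \<sigma>: "\<And>i. \<sigma> i \<in> behavior_strategies Act i"
    and t: "t \<in> plays Act"
  shows "emeasure (play_measure Act \<sigma>) {s \<in> plays Act. \<forall>k<n. s k = t k}
           = (\<Prod>k<n. \<Prod>i\<in>UNIV. ennreal (pmf (\<sigma> i (map t [0..<k])) (t k i)))"
proof -
  let ?A = "profiles Act" and ?M = "\<lambda>_::nat. count_space (profiles Act)"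
  interpret Ionescu_Tulcea "stage_kernel Act \<sigma>" ?M
    by (rule stage_kernel_Ionescu_Tulcea[OF fin \<sigma>])
  have finA: "finite ?A" by (rule finite_profiles[OF fin])
  have tA: "t k \<in> ?A" for k using t by (auto simp: plays_def)
  have PiM_eq: "PiM {0..<n} ?M = count_space (\<Pi>\<^sub>E k\<in>{0..<n}. ?A)" for n :: nat
    by (rule count_space_PiM_finite) (auto simp: finA countable_finite)
  let ?r = "\<lambda>n. restrict t {0..<n}"
  have r_space: "?r n \<in> space (PiM {0..<n} ?M)" for n
    using tA by (auto simp: space_PiM)
  have r_sets: "{?r n} \<in> sets (PiM {0..<n} ?M)" for n
    using r_space[of n] unfolding PiM_eq by simp
  have u: "(\<lambda>_. undefined) \<in> space (PiM {0..<0} ?M)" by (simp add: space_PiM)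
  have C: "emeasure (C 0 n (\<lambda>_. undefined)) {?r n}
      = (\<Prod>k<n. \<Prod>i\<in>UNIV. ennreal (pmf (\<sigma> i (map t [0..<k])) (t k i)))" for n
  proof (induction n)
    case 0
    then show ?case
      using r_sets[of 0] by (simp add: restrict_def)
  next
    case (Suc n)
    have K: "emeasure (eP n \<omega>) {?r (Suc n)} =
        (\<Prod>i\<in>UNIV. ennreal (pmf (\<sigma> i (map t [0..<n])) (t n i))) * indicator {?r n} \<omega>"
      if \<omega>: "\<omega> \<in> space (PiM {0..<n} ?M)" for \<omega>
    proof -
      have "emeasure (eP n \<omega>) {?r (Suc n)}
          = stage_kernel Act \<sigma> n \<omega> ((\<lambda>x. fun_upd \<omega> n x) -` {?r (Suc n)} \<inter> ?A)"
        using emeasure_eP[OF \<omega> r_sets] by simp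
      also have "(\<lambda>x. fun_upd \<omega> n x) -` {?r (Suc n)} \<inter> ?A = (if \<omega> = ?r n then {t n} else {})"
      proof (cases "\<omega> = ?r n")
        case True
        have "(fun_upd \<omega> n x = ?r (Suc n)) = (x = t n)" for x
        proof
          assume "fun_upd \<omega> n x = ?r (Suc n)"
          from fun_cong[OF this, of n] show "x = t n" by simp
        next
          assume "x = t n"
          then show "fun_upd \<omega> n x = ?r (Suc n)"
            unfolding True by (intro ext) (simp add: less_Suc_eq)
        qed
        then show ?thesis using tA[of n] True by auto
      next
        case False
        have "\<omega> n = undefined" using \<omega> by (auto simp: space_PiM PiE_def extensional_def)
        have "fun_upd \<omega> n x \<noteq> ?r (Suc n)" for x
        proof
          assume eq: "fun_upd \<omega> n x = ?r (Suc n)"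
          have "\<omega> k = ?r n k" for k
            using fun_cong[OF eq, of k] \<open>\<omega> n = undefined\<close> by (cases "k = n") auto
          with False show False by auto
        qed
        then show ?thesis using False by auto
      qed
      also have "stage_kernel Act \<sigma> n \<omega> (if \<omega> = ?r n then {t n} else {})
          = (\<Prod>i\<in>UNIV. ennreal (pmf (\<sigma> i (map t [0..<n])) (t n i))) * indicator {?r n} \<omega>"
      proof (cases "\<omega> = ?r n")
        case True
        then have m: "map \<omega> [0..<n] = map t [0..<n]" by simp
        have "stage_kernel Act \<sigma> n \<omega> {t n} = ennreal (pmf (stage_pmf \<sigma> (map t [0..<n])) (t n))"
          unfolding stage_kernel_def m using tA[of n]
          by (subst emeasure_restrict_space) (auto simp: emeasure_pmf_single)
        also have "\<dots> = (\<Prod>i\<in>UNIV. ennreal (pmf (\<sigma> i (map t [0..<n])) (t n i)))"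
          by (simp add: stage_pmf_def pmf_Pi prod_ennreal)
        finally show ?thesis using True by simp
      qed simp
      finally show ?thesis .
    qed
    have meas: "eP n \<in> measurable (C 0 n (\<lambda>_. undefined)) (subprob_algebra (PiM {0..<Suc n} ?M))"
      using measurable_eP[of n]
      by (subst measurable_cong_sets[OF sets_C[OF u, of n, unfolded add_0] refl])
    have "emeasure (C 0 (Suc n) (\<lambda>_. undefined)) {?r (Suc n)}
        = emeasure (C 0 n (\<lambda>_. undefined) \<bind> eP n) {?r (Suc n)}"
      by simp
    also have "\<dots> = (\<integral>\<^sup>+\<omega>. emeasure (eP n \<omega>) {?r (Suc n)} \<partial>C 0 n (\<lambda>_. undefined))"
      by (rule emeasure_bind[OF prob_space.not_empty[OF prob_space_C[OF u, of n]] meas r_sets])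
    also have "\<dots> = (\<integral>\<^sup>+\<omega>. (\<Prod>i\<in>UNIV. ennreal (pmf (\<sigma> i (map t [0..<n])) (t n i)))
        * indicator {?r n} \<omega> \<partial>C 0 n (\<lambda>_. undefined))"
      using space_C[OF u, of n] by (intro nn_integral_cong K) simp
    also have "\<dots> = (\<Prod>i\<in>UNIV. ennreal (pmf (\<sigma> i (map t [0..<n])) (t n i)))
        * emeasure (C 0 n (\<lambda>_. undefined)) {?r n}"
      using r_sets[of n] sets_C[OF u, of n] by (intro nn_integral_cmult_indicator) simp
    finally show ?case by (simp only: Suc prod.lessThan_Suc mult.commute)
  qed
  have "restrict s {0..<n} = ?r n \<longleftrightarrow> (\<forall>k<n. s k = t k)" for s
  proof
    assume eq: "restrict s {0..<n} = ?r n"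
    show "\<forall>k<n. s k = t k"
    proof (intro allI impI)
      fix k assume "k < n"
      with fun_cong[OF eq, of k] show "s k = t k" by simp
    qed
  qed (auto intro: restrict_ext)
  then have "{s \<in> plays Act. \<forall>k<n. s k = t k} = PF.emb UNIV {0..<n} {?r n}"
    by (auto simp: prod_emb_def plays_def space_PiM)
  then have "emeasure (play_measure Act \<sigma>) {s \<in> plays Act. \<forall>k<n. s k = t k}
      = emeasure (CI {0..<n}) {?r n}"
    using lim[OF _ r_sets[of n]] by (simp add: play_measure_def Let_def)
  also have "\<dots> = emeasure (C 0 n (\<lambda>_. undefined)) (PF.emb {0..<n} {0..<n} {?r n})"
    by (rule emeasure_CI) (auto simp: r_sets)
  also have "PF.emb {0..<n} {0..<n} {?r n} = {?r n}"
    using r_space[of n] by (intro prod_emb_id) (auto simp: space_PiM)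
  finally show ?thesis using C by simp
qed

lemma prob_space_play_measure:
  fixes Act :: "'i::finite \<Rightarrow> 'a set"
  assumes fin: "\<And>i. finite (Act i)" and \<sigma>: "\<And>i. \<sigma> i \<in> behavior_strategies Act i"
  shows "prob_space (play_measure Act \<sigma>)"
proof
  interpret Ionescu_Tulcea "stage_kernel Act \<sigma>" "\<lambda>_. count_space (profiles Act)"
    by (rule stage_kernel_Ionescu_Tulcea[OF fin \<sigma>])
  have sp: "space (play_measure Act \<sigma>) = plays Act"
    using sets_eq_imp_space_eq[OF sets_play_measure[OF fin \<sigma>]] by (simp add: space_play_borel)
  have "plays Act \<noteq> {}"
    using space_PiM_not_empty by (simp add: space_PiM plays_def)
  then obtain t where "t \<in> plays Act" by blast
  from emeasure_play_measure_cylinder[OF fin \<sigma> this, of 0]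
  show "emeasure (play_measure Act \<sigma>) (space (play_measure Act \<sigma>)) = 1"
    by (simp add: sp)
qed

lemma measure_play_measure_cylinder:
  fixes Act :: "'i::finite \<Rightarrow> 'a set"
  assumes "\<And>i. finite (Act i)" and "\<And>i. \<sigma> i \<in> behavior_strategies Act i" and "t \<in> plays Act"
  shows "measure (play_measure Act \<sigma>) {s \<in> plays Act. \<forall>k<n. s k = t k}
           = (\<Prod>k<n. \<Prod>i\<in>UNIV. pmf (\<sigma> i (map t [0..<k])) (t k i))"
  using emeasure_play_measure_cylinder[OF assms, of n]
  by (simp add: measure_def prod_ennreal prod_nonneg)

end

theory Submission
  imports Defs
begin

text \<open>
  Suppose first that there are only finitely many outcomes and that each player has one fixed
  deviation. Let \<open>P\<close> be the prescribed law, \<open>Q\<^sub>i\<close> the law when player \<open>i\<close> deviates, and \<open>R\<^sub>i\<^sub>j\<close> the law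
  when \<open>i\<close> and \<open>j\<close> both deviate. Since players randomize independently,
  \<open>Q\<^sub>i(h) Q\<^sub>j(h) = P(h) R\<^sub>i\<^sub>j(h)\<close> for every history \<open>h\<close> (\<open>measure_cylinder_two_deviators\<close>). Hence
  \<open>sqrt (Q\<^sub>i(h) Q\<^sub>j(h))\<close> sums over the unsuccessful outcomes to at most \<open>sqrt (P(D\<^sup>c)) < sqrt \<epsilon>\<close> by the
  Cauchy-Schwarz inequality: on an event that is unlikely without deviations, any two deviations by
  different players are nearly singular to each other, and the deviator can be read off with small
  error.

  This argument survives averaging over deviations, so it bounds the error of the Bayes rule against
  every prior on deviations. A minimax theorem (\<open>convexlike_alternative\<close>) converts it into one
  randomized rule that is good against all of finitely many deviations; blaming a player whom this rule
  blames with maximal probability makes it deterministic and costs the factor \<open>2\<close> (\<open>finite_blame\<close>).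

  To reach plays of infinite length, the complement of \<open>D\<close> is covered by disjoint cylinders of total
  probability below \<open>\<epsilon>\<close> (\<open>cover_by_disjoint_cylinders\<close>), which is possible because the inequality in
  the hypothesis is strict. Blame is then a function from countably many finite histories to a finite
  set of players, and compactness (\<open>finitely_determined_choice\<close>) handles all deviations and all
  histories at once (\<open>exists_blame_on_histories\<close>). The outcome is the bound \<open>2 * sqrt \<epsilon>\<close>, which implies the
  stated one when there are at least two players.
\<close>

section \<open>Theorems of the alternative for convexlike functions\<close>

text \<open>
  Call \<open>x\<close> bad for \<open>v\<close> if \<open>v x < 0\<close>. A multiplier \<open>c \<ge> 0\<close> with \<open>u + c v \<ge> 0\<close> everywhere has to satisfy
  an upper bound from each point bad for \<open>v\<close> and a lower bound from each point bad for \<open>u\<close>. The bounds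
  are compatible (fact \<open>cross\<close>) because otherwise a mixture of the two points would be bad for both
  functions, so the infimum of the upper bounds works.
\<close>

lemma two_function_alternative:
  fixes u v :: "'x \<Rightarrow> real"
  assumes mix: "\<And>x y t. \<lbrakk>x \<in> X; y \<in> X; 0 \<le> t; t \<le> 1\<rbrakk> \<Longrightarrow>
      \<exists>z\<in>X. u z \<le> t * u x + (1 - t) * u y \<and> v z \<le> t * v x + (1 - t) * v y"
    and nonneg: "\<And>x. x \<in> X \<Longrightarrow> 0 \<le> u x \<or> 0 \<le> v x"
  shows "\<exists>s. 0 \<le> s \<and> s \<le> 1 \<and> (\<forall>x\<in>X. 0 \<le> (1 - s) * u x + s * v x)"
proof (cases "\<exists>a\<in>X. v a < 0")
  case False
  then show ?thesis by (intro exI[of _ 1]) force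
next
  case True
  define A where "A = {a \<in> X. v a < 0}"
  have A_nonempty: "A \<noteq> {}" using True by (auto simp: A_def)
  have u_A: "0 \<le> u a" if "a \<in> A" for a using nonneg[of a] that by (auto simp: A_def)
  have cross: "u b * v a \<le> u a * v b" if a: "a \<in> A" and b: "b \<in> X" "u b < 0" for a b
  proof (rule ccontr)
    assume "\<not> u b * v a \<le> u a * v b"
    then have less: "u a * v b < u b * v a" by simp
    have va: "v a < 0" "a \<in> X" and ua: "0 \<le> u a" and vb: "0 \<le> v b"
      using a u_A[OF a] nonneg[OF b(1)] b(2) by (auto simp: A_def)
    \<comment> \<open>This weight makes both mixed values equal to \<open>(u a * v b - u b * v a) / d\<close>.\<close>
    define d where "d = v b - u b + (u a - v a)"
    define t where "t = (v b - u b) / d"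
    have d: "d > 0" using va ua vb b unfolding d_def by linarith
    have t1: "1 - t = (u a - v a) / d" using d by (simp add: t_def d_def field_simps)
    have "0 \<le> t" "t \<le> 1" using d va ua vb b by (auto simp: t_def d_def)
    from mix[OF va(2) b(1) this] obtain z where z: "z \<in> X"
      "u z \<le> t * u a + (1 - t) * u b" "v z \<le> t * v a + (1 - t) * v b" by blast
    have "t * u a + (1 - t) * u b = (u a * v b - u b * v a) / d"
      unfolding t1 unfolding t_def using d by (simp add: field_simps)
    also have "\<dots> < 0" using less d by (simp add: divide_neg_pos)
    finally have "u z < 0" using z by linarith
    have "t * v a + (1 - t) * v b = (u a * v b - u b * v a) / d"
      unfolding t1 unfolding t_def using d by (simp add: field_simps)
    also have "\<dots> < 0" using less d by (simp add: divide_neg_pos)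
    finally have "v z < 0" using z by linarith
    with \<open>u z < 0\<close> nonneg[OF z(1)] show False by linarith
  qed
  define c where "c = (INF a\<in>A. u a / - v a)"
  have bdd: "bdd_below ((\<lambda>a. u a / - v a) ` A)"
    using u_A by (intro bdd_belowI2[of _ 0]) (auto simp: A_def divide_nonneg_neg)
  have c0: "0 \<le> c"
    unfolding c_def using A_nonempty u_A by (intro cINF_greatest) (auto simp: A_def divide_nonneg_neg)
  have c: "0 \<le> u x + c * v x" if x: "x \<in> X" for x
  proof (cases "v x < 0")
    case True
    then have "c \<le> u x / - v x" unfolding c_def using x by (intro cINF_lower[OF bdd]) (auto simp: A_def)
    then show ?thesis using True by (simp add: field_simps)
  next
    case vx: False
    show ?thesis
    proof (cases "u x < 0")
      case True
      obtain a where a: "a \<in> A" using A_nonempty by blast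
      have "0 < u x * v a" using True a by (auto simp: A_def mult_neg_neg)
      with cross[OF a x True] vx have vx: "0 < v x" by (cases "v x = 0") auto
      have "- u x / v x \<le> c"
        unfolding c_def
      proof (rule cINF_greatest[OF A_nonempty])
        fix a assume a: "a \<in> A"
        show "- u x / v x \<le> u a / - v a"
          using cross[OF a x True] a vx by (simp add: A_def field_simps)
      qed
      then show ?thesis using vx by (simp add: field_simps)
    next
      case False
      then show ?thesis using vx c0 by simp
    qed
  qed
  have "0 \<le> (1 - c / (1 + c)) * u x + c / (1 + c) * v x" if "x \<in> X" for x
  proof -
    have "(1 - c / (1 + c)) * u x + c / (1 + c) * v x = (u x + c * v x) / (1 + c)"
    proof -
      have "1 - c / (1 + c) = 1 / (1 + c)" using c0 by (simp add: field_simps)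
      then show ?thesis by (simp add: add_divide_distrib)
    qed
    then show ?thesis using c[OF that] c0 by simp
  qed
  then show ?thesis using c0 by (intro exI[of _ "c / (1 + c)"]) auto
qed

text \<open>
  The form of the minimax theorem used below: if no point makes all of finitely many functions
  negative, then some convex combination of them is nonnegative throughout. Restricting \<open>X\<close> to the
  points where the newest function is negative leaves a system of the same kind with one function
  less; its weights combine the old functions into a single one, and the case of two functions
  settles the rest.
\<close>

lemma convexlike_alternative:
  fixes g :: "'k \<Rightarrow> 'x \<Rightarrow> real"
  assumes "finite Y" "Y \<noteq> {}"
    and "\<And>x y t. \<lbrakk>x \<in> X; y \<in> X; 0 \<le> t; t \<le> 1\<rbrakk> \<Longrightarrow>
      \<exists>z\<in>X. \<forall>k\<in>Y. g k z \<le> t * g k x + (1 - t) * g k y"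
    and "\<And>x. x \<in> X \<Longrightarrow> \<exists>k\<in>Y. 0 \<le> g k x"
  shows "\<exists>w. (\<forall>k\<in>Y. 0 \<le> w k) \<and> sum w Y = 1 \<and> (\<forall>x\<in>X. 0 \<le> (\<Sum>k\<in>Y. w k * g k x))"
  using assms
proof (induction Y arbitrary: X rule: finite_ne_induct)
  case (singleton k)
  then show ?case by (intro exI[of _ "\<lambda>_. 1"]) auto
next
  case (insert k Y)
  note mix = insert.prems(1)
  have "\<exists>w. (\<forall>j\<in>Y. 0 \<le> w j) \<and> sum w Y = 1 \<and>
      (\<forall>x\<in>{x\<in>X. g k x < 0}. 0 \<le> (\<Sum>j\<in>Y. w j * g j x))"
  proof (rule insert.IH)
    fix x y and t :: real
    assume x: "x \<in> {x\<in>X. g k x < 0}" and y: "y \<in> {x\<in>X. g k x < 0}" and t: "0 \<le> t" "t \<le> 1"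
    from mix[of x y t] x y t obtain z
      where z: "z \<in> X" "\<forall>j\<in>insert k Y. g j z \<le> t * g j x + (1 - t) * g j y" by auto
    have "t * g k x + (1 - t) * g k y < 0"
    proof (cases "t = 0")
      case False
      then have "t * g k x < 0" "(1 - t) * g k y \<le> 0"
        using x y t by (auto simp: mult_pos_neg mult_nonneg_nonpos)
      then show ?thesis by linarith
    qed (use y in auto)
    then show "\<exists>z\<in>{x\<in>X. g k x < 0}. \<forall>j\<in>Y. g j z \<le> t * g j x + (1 - t) * g j y"
      using z by (intro bexI[of _ z]) force+
  next
    fix x assume "x \<in> {x\<in>X. g k x < 0}"
    then show "\<exists>j\<in>Y. 0 \<le> g j x" using insert.prems(2)[of x] by auto
  qed
  then obtain w where w: "\<forall>j\<in>Y. 0 \<le> w j" "sum w Y = 1"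
    and wx: "\<And>x. \<lbrakk>x \<in> X; g k x < 0\<rbrakk> \<Longrightarrow> 0 \<le> (\<Sum>j\<in>Y. w j * g j x)" by auto
  have "\<exists>s. 0 \<le> s \<and> s \<le> 1 \<and> (\<forall>x\<in>X. 0 \<le> (1 - s) * (\<Sum>j\<in>Y. w j * g j x) + s * g k x)"
  proof (rule two_function_alternative)
    fix x y and t :: real
    assume "x \<in> X" "y \<in> X" "0 \<le> t" "t \<le> 1"
    from mix[OF this] obtain z
      where z: "z \<in> X" "\<forall>j\<in>insert k Y. g j z \<le> t * g j x + (1 - t) * g j y" by blast
    have "(\<Sum>j\<in>Y. w j * g j z) \<le> (\<Sum>j\<in>Y. w j * (t * g j x + (1 - t) * g j y))"
      using z w by (intro sum_mono mult_left_mono) auto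
    also have "\<dots> = t * (\<Sum>j\<in>Y. w j * g j x) + (1 - t) * (\<Sum>j\<in>Y. w j * g j y)"
      by (simp add: sum_distrib_left flip: sum.distrib) (simp add: algebra_simps)
    finally show "\<exists>z\<in>X. (\<Sum>j\<in>Y. w j * g j z) \<le> t * (\<Sum>j\<in>Y. w j * g j x) + (1 - t) * (\<Sum>j\<in>Y. w j * g j y)
        \<and> g k z \<le> t * g k x + (1 - t) * g k y" using z by auto
  next
    fix x assume "x \<in> X"
    then show "0 \<le> (\<Sum>j\<in>Y. w j * g j x) \<or> 0 \<le> g k x" using wx by force
  qed
  then obtain s where s: "0 \<le> s" "s \<le> 1"
    "\<forall>x\<in>X. 0 \<le> (1 - s) * (\<Sum>j\<in>Y. w j * g j x) + s * g k x" by blast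
  define w' where "w' j = (if j = k then s else (1 - s) * w j)" for j
  have split: "(\<Sum>j\<in>insert k Y. w' j * a j) = (1 - s) * (\<Sum>j\<in>Y. w j * a j) + s * a k" for a
  proof -
    have "(\<Sum>j\<in>Y. w' j * a j) = (\<Sum>j\<in>Y. (1 - s) * (w j * a j))"
      using insert.hyps by (intro sum.cong) (auto simp: w'_def)
    then show ?thesis using insert.hyps by (simp add: w'_def sum_distrib_left)
  qed
  have "sum w' (insert k Y) = 1" using split[of "\<lambda>_. 1"] w by simp
  moreover have "\<forall>j\<in>insert k Y. 0 \<le> w' j" using w s by (auto simp: w'_def)
  ultimately show ?case using s(3) split by (intro exI[of _ w']) auto
qed

section \<open>Blaming on finitely many events\<close>

lemma exists_argmax:
  fixes x :: "'i::finite \<Rightarrow> real"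
  shows "\<exists>i. \<forall>j. x j \<le> x i"
proof -
  have "Max (range x) \<in> range x" by (intro Max_in) auto
  then obtain i where "x i = Max (range x)" by (metis imageE)
  then show ?thesis by (metis Max_ge finite rangeI finite_imageI)
qed

text \<open>
  With \<open>T\<close> the sum that omits the largest entry, \<open>T \<le> (\<Sum>k\<in>-{j}. x k)\<close> for every \<open>j\<close>, so that each
  term of \<open>T\<^sup>2 = (\<Sum>j\<in>-{i}. x j * T)\<close> is dominated by products of entries at distinct indices. Only
  such products can be controlled when the entries are likelihoods of deviations by different
  players.
\<close>

lemma sum_off_argmax_squared_le:
  fixes x :: "'i::finite \<Rightarrow> real"
  assumes pos: "\<And>j. 0 \<le> x j" and max: "\<And>j. x j \<le> x i"
  shows "(\<Sum>j\<in>-{i}. x j)\<^sup>2 \<le> (\<Sum>j\<in>UNIV. \<Sum>k\<in>-{j}. x j * x k)"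
proof -
  let ?T = "\<Sum>k\<in>-{i}. x k"
  have "?T \<le> (\<Sum>k\<in>-{j}. x k)" for j
  proof (cases "j = i")
    case False
    have a: "?T = x j + (\<Sum>k\<in>-{i}-{j}. x k)" using False by (intro sum.remove) auto
    have b: "(\<Sum>k\<in>-{j}. x k) = x i + (\<Sum>k\<in>-{j}-{i}. x k)" using False by (intro sum.remove) auto
    have "-{i}-{j} = -{j}-{i}" by auto
    then show ?thesis using a b max[of j] by simp
  qed simp
  then have *: "x j * ?T \<le> (\<Sum>k\<in>-{j}. x j * x k)" for j
    using pos[of j] by (simp add: mult_left_mono flip: sum_distrib_left)
  have "?T\<^sup>2 = (\<Sum>j\<in>-{i}. x j * ?T)" by (simp add: power2_eq_square sum_distrib_right)
  also have "\<dots> \<le> (\<Sum>j\<in>-{i}. \<Sum>k\<in>-{j}. x j * x k)" by (intro sum_mono *)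
  also have "\<dots> \<le> (\<Sum>j\<in>UNIV. \<Sum>k\<in>-{j}. x j * x k)"
    using pos by (intro sum_mono2 sum_nonneg) auto
  finally show ?thesis .
qed

text \<open>
  The core estimate. An element \<open>y\<close> of \<open>Y\<close> is a deviation by player \<open>pl y\<close>, \<open>h\<close> ranges over finitely
  many disjoint events, \<open>p h\<close> is the probability of \<open>h\<close> without deviation, \<open>q y h\<close> that under \<open>y\<close>, and
  \<open>r y z h\<close> that under the simultaneous deviations \<open>y\<close> and \<open>z\<close>.

  By the theorem of the alternative it is enough to answer a known prior \<open>w\<close> on deviations. The best
  answer blames the player with the largest posterior weight, and its error at \<open>h\<close> is the sum that
  omits the largest weight, hence at most \<open>sqrt (p h * R h)\<close>, where \<open>R\<close> averages \<open>r\<close>. By the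
  Cauchy-Schwarz inequality the total error is below \<open>sqrt \<epsilon>\<close>. The minimax argument yields a
  randomized answer; blaming a player of maximal probability instead at most doubles the error, since
  a player who is not chosen was blamed with probability at most \<open>1/2\<close>.
\<close>

lemma finite_blame:
  fixes pl :: "'k \<Rightarrow> 'i::finite" and q :: "'k \<Rightarrow> 'h \<Rightarrow> real"
  assumes fin: "finite Y" "finite H"
    and q0: "\<And>y h. \<lbrakk>y \<in> Y; h \<in> H\<rbrakk> \<Longrightarrow> 0 \<le> q y h"
    and p0: "\<And>h. h \<in> H \<Longrightarrow> 0 \<le> p h"
    and r0: "\<And>y z h. \<lbrakk>y \<in> Y; z \<in> Y; h \<in> H\<rbrakk> \<Longrightarrow> 0 \<le> r y z h"
    and qq: "\<And>y z h. \<lbrakk>y \<in> Y; z \<in> Y; h \<in> H; pl y \<noteq> pl z\<rbrakk> \<Longrightarrow> q y h * q z h = p h * r y z h"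
    and r1: "\<And>y z. \<lbrakk>y \<in> Y; z \<in> Y; pl y \<noteq> pl z\<rbrakk> \<Longrightarrow> (\<Sum>h\<in>H. r y z h) \<le> 1"
    and p: "(\<Sum>h\<in>H. p h) < \<epsilon>"
  shows "\<exists>f. \<forall>y\<in>Y. (\<Sum>h\<in>{h\<in>H. f h \<noteq> pl y}. q y h) \<le> 2 * sqrt \<epsilon>"
proof (cases "Y = {}")
  case False
  define X where "X = {x :: 'h \<Rightarrow> 'i \<Rightarrow> real. \<forall>h. (\<forall>i. 0 \<le> x h i) \<and> (\<Sum>i\<in>UNIV. x h i) = 1}"
  define loss where "loss y x = (\<Sum>h\<in>H. (1 - x h (pl y)) * q y h)" for y and x :: "'h \<Rightarrow> 'i \<Rightarrow> real"
  \<comment> \<open>The witness is the Bayes rule \<open>b\<close> for the prior \<open>w\<close>, as a degenerate randomized answer.\<close>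
  have bayes: "\<exists>x\<in>X. (\<Sum>y\<in>Y. w y * (loss y x - sqrt \<epsilon>)) < 0"
    if w: "\<forall>y\<in>Y. 0 \<le> w y" "sum w Y = 1" for w
  proof -
    define m where "m h i = (\<Sum>y\<in>{y\<in>Y. pl y = i}. w y * q y h)" for h i
    have m0: "0 \<le> m h i" if "h \<in> H" for h i
      using that w q0 by (auto simp: m_def intro!: sum_nonneg)
    obtain b where b: "\<And>h j. m h j \<le> m h (b h)"
      using exists_argmax[of "m _"] by metis
    define x where "x h i = (if i = b h then 1 else 0 :: real)" for h i
    have "x \<in> X" by (simp add: X_def x_def)
    define R where "R h = (\<Sum>y\<in>Y. \<Sum>z\<in>{z\<in>Y. pl z \<noteq> pl y}. w y * w z * r y z h)" for h
    have R0: "0 \<le> R h" if "h \<in> H" for h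
      using that w r0 by (auto simp: R_def intro!: sum_nonneg)
    have R1: "(\<Sum>h\<in>H. R h) \<le> 1"
    proof -
      have "(\<Sum>h\<in>H. R h) = (\<Sum>y\<in>Y. \<Sum>z\<in>{z\<in>Y. pl z \<noteq> pl y}. \<Sum>h\<in>H. w y * w z * r y z h)"
        unfolding R_def
        by (subst sum.swap, rule sum.cong[OF refl], rule sum.swap)
      also have "\<dots> \<le> (\<Sum>y\<in>Y. \<Sum>z\<in>{z\<in>Y. pl z \<noteq> pl y}. w y * w z)"
        using w r1 by (intro sum_mono) (auto simp: mult_left_le simp flip: sum_distrib_left)
      also have "\<dots> \<le> (\<Sum>y\<in>Y. \<Sum>z\<in>Y. w y * w z)"
        using w fin by (intro sum_mono sum_mono2) auto
      also have "\<dots> = 1" using w by (simp flip: sum_distrib_left)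
      finally show ?thesis .
    qed
    have pointwise: "(\<Sum>j\<in>-{b h}. m h j) \<le> sqrt (p h) * sqrt (R h)" if h: "h \<in> H" for h
    proof -
      have "(\<Sum>j\<in>-{b h}. m h j)\<^sup>2 \<le> (\<Sum>j\<in>UNIV. \<Sum>k\<in>-{j}. m h j * m h k)"
        using m0[OF h] b by (intro sum_off_argmax_squared_le)
      also have "\<dots> = (\<Sum>j\<in>UNIV. \<Sum>y\<in>{y\<in>Y. pl y = j}. w y * q y h * (\<Sum>k\<in>-{j}. m h k))"
        by (simp add: m_def[of h] sum_distrib_left[symmetric] sum_distrib_right[symmetric])
      also have "\<dots> = (\<Sum>j\<in>UNIV. \<Sum>y\<in>{y\<in>Y. pl y = j}. w y * q y h * (\<Sum>k\<in>-{pl y}. m h k))"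
        by (intro sum.cong) auto
      also have "\<dots> = (\<Sum>y\<in>Y. w y * q y h * (\<Sum>k\<in>-{pl y}. m h k))"
        using fin by (intro sum.group) auto
      also have "\<dots> = (\<Sum>y\<in>Y. w y * q y h * (\<Sum>z\<in>{z\<in>Y. pl z \<noteq> pl y}. w z * q z h))"
      proof (intro sum.cong refl arg_cong[where f = "(*) _"])
        fix y
        have "(\<Sum>k\<in>-{pl y}. m h k)
            = (\<Sum>k\<in>-{pl y}. \<Sum>z\<in>{z\<in>{z\<in>Y. pl z \<noteq> pl y}. pl z = k}. w z * q z h)"
          unfolding m_def by (intro sum.cong) auto
        also have "\<dots> = (\<Sum>z\<in>{z\<in>Y. pl z \<noteq> pl y}. w z * q z h)"
          using fin by (intro sum.group) auto
        finally show "(\<Sum>k\<in>-{pl y}. m h k) = (\<Sum>z\<in>{z\<in>Y. pl z \<noteq> pl y}. w z * q z h)" .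
      qed
      also have "\<dots> = (\<Sum>y\<in>Y. \<Sum>z\<in>{z\<in>Y. pl z \<noteq> pl y}. p h * (w y * w z * r y z h))"
        unfolding sum_distrib_left
      proof (intro sum.cong refl)
        fix y z assume "y \<in> Y" "z \<in> {z\<in>Y. pl z \<noteq> pl y}"
        then have "q y h * q z h = p h * r y z h" using qq h by auto
        then have "w y * w z * (q y h * q z h) = w y * w z * (p h * r y z h)" by simp
        then show "w y * q y h * (w z * q z h) = p h * (w y * w z * r y z h)" by (simp add: ac_simps)
      qed
      also have "\<dots> = p h * R h" by (simp add: R_def sum_distrib_left)
      finally have "(\<Sum>j\<in>-{b h}. m h j) \<le> sqrt (p h * R h)" by (rule real_le_rsqrt)
      then show ?thesis by (simp add: real_sqrt_mult)
    qed
    have "(\<Sum>y\<in>Y. w y * loss y x) = (\<Sum>h\<in>H. \<Sum>y\<in>Y. (1 - x h (pl y)) * (w y * q y h))"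
      unfolding loss_def sum_distrib_left by (subst sum.swap) (simp add: ac_simps)
    also have "\<dots> = (\<Sum>h\<in>H. \<Sum>j\<in>-{b h}. m h j)"
    proof (intro sum.cong refl)
      fix h
      have "(\<Sum>y\<in>Y. (1 - x h (pl y)) * (w y * q y h))
          = (\<Sum>j\<in>UNIV. \<Sum>y\<in>{y\<in>Y. pl y = j}. (1 - x h (pl y)) * (w y * q y h))"
        using fin by (intro sum.group[symmetric]) auto
      also have "\<dots> = (\<Sum>j\<in>UNIV. (1 - x h j) * m h j)"
        unfolding m_def sum_distrib_left by (intro sum.cong) auto
      also have "\<dots> = (\<Sum>j\<in>-{b h}. m h j)"
        by (intro sum.mono_neutral_cong_right) (auto simp: x_def)
      finally show "(\<Sum>y\<in>Y. (1 - x h (pl y)) * (w y * q y h)) = (\<Sum>j\<in>-{b h}. m h j)" .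
    qed
    also have "\<dots> \<le> (\<Sum>h\<in>H. sqrt (p h) * sqrt (R h))" by (intro sum_mono pointwise)
    also have "\<dots> \<le> sqrt (\<Sum>h\<in>H. p h) * sqrt (\<Sum>h\<in>H. R h)"
      using L2_set_mult_ineq[of "\<lambda>h. sqrt (p h)" "\<lambda>h. sqrt (R h)" H] p0 R0
      by (simp add: L2_set_def)
    also have "\<dots> \<le> sqrt (\<Sum>h\<in>H. p h)" using R1 p0 R0
      by (intro mult_left_le) (auto intro!: sum_nonneg)
    also have "\<dots> < sqrt \<epsilon>" using p by simp
    finally have "(\<Sum>y\<in>Y. w y * loss y x) < sqrt \<epsilon>" .
    moreover have "(\<Sum>y\<in>Y. w y * (loss y x - sqrt \<epsilon>)) = (\<Sum>y\<in>Y. w y * loss y x) - sum w Y * sqrt \<epsilon>"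
      by (simp add: right_diff_distrib sum_subtractf sum_distrib_right)
    ultimately show ?thesis using w \<open>x \<in> X\<close> by (intro bexI[of _ x]) auto
  qed
  have "\<exists>x\<in>X. \<forall>y\<in>Y. loss y x - sqrt \<epsilon> < 0"
  proof (rule ccontr)
    assume no: "\<not> (\<exists>x\<in>X. \<forall>y\<in>Y. loss y x - sqrt \<epsilon> < 0)"
    have "\<exists>w. (\<forall>y\<in>Y. 0 \<le> w y) \<and> sum w Y = 1 \<and> (\<forall>x\<in>X. 0 \<le> (\<Sum>y\<in>Y. w y * (loss y x - sqrt \<epsilon>)))"
    proof (rule convexlike_alternative[OF fin(1) False])
      fix x x' and t :: real assume x: "x \<in> X" "x' \<in> X" and t: "0 \<le> t" "t \<le> 1"
      define z where "z h i = t * x h i + (1 - t) * x' h i" for h i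
      have "z \<in> X" using x t unfolding X_def
        by (auto simp: z_def sum.distrib simp flip: sum_distrib_left)
      moreover have "loss y z = t * loss y x + (1 - t) * loss y x'" for y
        unfolding loss_def z_def sum_distrib_left sum.distrib[symmetric]
        by (intro sum.cong refl) (simp add: algebra_simps)
      ultimately show "\<exists>z\<in>X. \<forall>y\<in>Y. loss y z - sqrt \<epsilon>
          \<le> t * (loss y x - sqrt \<epsilon>) + (1 - t) * (loss y x' - sqrt \<epsilon>)"
        by (intro bexI[of _ z]) (auto simp: algebra_simps)
    qed (use no in force)
    then obtain w where w: "\<forall>y\<in>Y. 0 \<le> w y" "sum w Y = 1"
      and ge: "\<And>x. x \<in> X \<Longrightarrow> 0 \<le> (\<Sum>y\<in>Y. w y * (loss y x - sqrt \<epsilon>))" by blast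
    from bayes[OF w] obtain x where "x \<in> X" "(\<Sum>y\<in>Y. w y * (loss y x - sqrt \<epsilon>)) < 0" by blast
    with ge[of x] show False by simp
  qed
  then obtain x where x: "x \<in> X" "\<And>y. y \<in> Y \<Longrightarrow> loss y x \<le> sqrt \<epsilon>" by force
  obtain f where f: "\<And>h j. x h j \<le> x h (f h)"
    using exists_argmax[of "x _"] by metis
  \<comment> \<open>The two entries \<open>x h i\<close> and \<open>x h (f h)\<close> share a total of at most \<open>1\<close>, and the second is at least as large.\<close>
  have half: "1 \<le> 2 * (1 - x h i)" if "f h \<noteq> i" for h i
  proof -
    have "x h i + x h (f h) = sum (x h) {i, f h}" using that by simp
    also have "\<dots> \<le> sum (x h) UNIV" using x(1) by (intro sum_mono2) (auto simp: X_def)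
    also have "\<dots> = 1" using x(1) by (simp add: X_def)
    finally show ?thesis using f[of h i] by simp
  qed
  have le1: "x h i \<le> 1" for h i
    using member_le_sum[of i UNIV "x h"] x(1) by (auto simp: X_def)
  have "(\<Sum>h\<in>{h\<in>H. f h \<noteq> pl y}. q y h) \<le> 2 * sqrt \<epsilon>" if y: "y \<in> Y" for y
  proof -
    have "(\<Sum>h\<in>{h\<in>H. f h \<noteq> pl y}. q y h) \<le> (\<Sum>h\<in>{h\<in>H. f h \<noteq> pl y}. 2 * (1 - x h (pl y)) * q y h)"
      using mult_right_mono[OF half q0[OF y]] by (intro sum_mono) auto
    also have "\<dots> \<le> (\<Sum>h\<in>H. 2 * (1 - x h (pl y)) * q y h)"
      using fin q0[OF y] le1 by (intro sum_mono2) auto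
    also have "\<dots> = 2 * loss y x" by (simp only: loss_def sum_distrib_left mult.assoc)
    finally show ?thesis using x(2)[OF y] by simp
  qed
  then show ?thesis by blast
qed simp

section \<open>Compactness\<close>

text \<open>
  Conditions on a function with values in a finite type that involve only finitely many arguments each
  are closed in the product topology; Tychonoff's theorem turns joint satisfiability of any
  finitely many of them into joint satisfiability of all.
\<close>

lemma finitely_determined_choice:
  fixes K :: "'k \<Rightarrow> ('h \<Rightarrow> 'i::finite) set"
  assumes fin: "\<And>k. k \<in> I \<Longrightarrow> finite (S k)"
    and det: "\<And>k f g. \<lbrakk>k \<in> I; f \<in> K k; \<And>h. h \<in> S k \<Longrightarrow> g h = f h\<rbrakk> \<Longrightarrow> g \<in> K k"
    and fip: "\<And>J. \<lbrakk>finite J; J \<subseteq> I\<rbrakk> \<Longrightarrow> (\<Inter>k\<in>J. K k) \<noteq> {}"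
  shows "\<exists>f. \<forall>k\<in>I. f \<in> K k"
proof -
  let ?T = "product_topology (\<lambda>_::'h. discrete_topology (UNIV::'i set)) UNIV"
  have top: "topspace ?T = UNIV" by simp
  have compact: "compact_space ?T"
    by (simp add: compact_space_product_topology compact_space_discrete_topology)
  have "closedin ?T (K k)" if k: "k \<in> I" for k
  proof -
    have "openin ?T (- K k)"
    proof (subst openin_subopen, safe)
      fix f assume f: "f \<notin> K k"
      let ?U = "PiE UNIV (\<lambda>h. if h \<in> S k then {f h} else UNIV)"
      have "finite {h. (if h \<in> S k then {f h} else UNIV) \<noteq> (UNIV::'i set)}"
        by (rule finite_subset[OF _ fin[OF k]]) auto
      then have "openin ?T ?U" by (intro product_topology_basis) auto
      moreover have "f \<in> ?U" by auto
      moreover have "?U \<subseteq> - K k"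
      proof
        fix g assume g: "g \<in> ?U"
        have "f h = g h" if "h \<in> S k" for h using PiE_mem[OF g, of h] that by simp
        then show "g \<in> - K k" using det[OF k, of g f] f by auto
      qed
      ultimately show "\<exists>U. openin ?T U \<and> f \<in> U \<and> U \<subseteq> - K k" by blast
    qed
    then show ?thesis by (simp add: closedin_def top Compl_eq_Diff_UNIV)
  qed
  moreover have "\<Inter>\<F> \<noteq> {}" if "finite \<F>" "\<F> \<subseteq> K ` I" for \<F>
    using that fip by (metis finite_subset_image)
  ultimately have "\<Inter>(K ` I) \<noteq> {}"
    using compact[unfolded compact_space_fip, rule_format, of "K ` I"] by auto
  then show ?thesis by blast
qed

section \<open>Cylinders and outer approximation\<close>

definition cylinder :: "('i \<Rightarrow> 'a set) \<Rightarrow> ('i \<Rightarrow> 'a) list \<Rightarrow> (nat \<Rightarrow> 'i \<Rightarrow> 'a) set" where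
  "cylinder Act l = {s \<in> plays Act. \<forall>k<length l. s k = l ! k}"

text \<open>The open subsets of the space of plays, described through histories.\<close>

definition finitely_certified :: "('i \<Rightarrow> 'a set) \<Rightarrow> (nat \<Rightarrow> 'i \<Rightarrow> 'a) set \<Rightarrow> bool" where
  "finitely_certified Act U \<longleftrightarrow>
     U \<subseteq> plays Act \<and> (\<forall>s\<in>U. \<exists>n. cylinder Act (map s [0..<n]) \<subseteq> U)"

lemma mem_cylinder_iff: "s \<in> cylinder Act l \<longleftrightarrow> s \<in> plays Act \<and> map s [0..<length l] = l"
proof -
  have "map s [0..<length l] = l \<longleftrightarrow> (\<forall>k<length l. s k = l ! k)"
    by (subst list_eq_iff_nth_eq) simp
  then show ?thesis by (simp only: cylinder_def mem_Collect_eq)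
qed

lemma mem_cylinder_map: "s \<in> plays Act \<Longrightarrow> s \<in> cylinder Act (map s [0..<n])"
  by (simp add: cylinder_def)

lemma cylinder_map_antimono:
  "m \<le> n \<Longrightarrow> cylinder Act (map s [0..<n]) \<subseteq> cylinder Act (map s [0..<m])"
  by (auto simp: cylinder_def)

lemma measurable_coordinate:
  fixes Act :: "'i::finite \<Rightarrow> 'a set"
  assumes fin: "\<And>i. finite (Act i)"
  shows "(\<lambda>s. s n) \<in> measurable (play_borel Act) (count_space (profiles Act))"
  unfolding measurable_cong_sets[OF sets_PiM_profiles[where Act = Act, OF fin, symmetric] refl]
  by (rule measurable_component_singleton) simp

lemma sets_cylinder:
  fixes Act :: "'i::finite \<Rightarrow> 'a set"
  assumes fin: "\<And>i. finite (Act i)"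
  shows "cylinder Act l \<in> sets (play_borel Act)"
proof -
  have "{s \<in> space (play_borel Act). s k = l ! k} \<in> sets (play_borel Act)" for k
  proof -
    have "{s \<in> space (play_borel Act). s k = l ! k}
        = (\<lambda>s. s k) -` ({l ! k} \<inter> profiles Act) \<inter> space (play_borel Act)"
      by (auto simp: space_play_borel plays_def)
    also have "\<dots> \<in> sets (play_borel Act)"
      by (rule measurable_sets[OF measurable_coordinate[where Act = Act, OF fin]]) simp
    finally show ?thesis .
  qed
  then have "{s \<in> space (play_borel Act). \<forall>k\<in>{..<length l}. s k = l ! k} \<in> sets (play_borel Act)"
    by (intro sets.sets_Collect_finite_All) auto
  moreover have "cylinder Act l = {s \<in> space (play_borel Act). \<forall>k\<in>{..<length l}. s k = l ! k}"
    unfolding cylinder_def space_play_borel by blast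
  ultimately show ?thesis by (simp only:)
qed

lemma sets_Union_cylinder:
  fixes Act :: "'i::finite \<Rightarrow> 'a set"
  assumes fin: "\<And>i. finite (Act i)" and M: "M \<subseteq> lists (profiles Act)"
  shows "(\<Union>l\<in>M. cylinder Act l) \<in> sets (play_borel Act)"
proof (rule sets.countable_UN'')
  show "countable M"
    using M finite_profiles[of Act, OF fin]
    by (intro countable_subset[OF M]) (simp add: countable_finite)
qed (rule sets_cylinder[where Act = Act, OF fin])

lemma finitely_certified_UN:
  assumes "\<And>k. k \<in> K \<Longrightarrow> finitely_certified Act (U k)"
  shows "finitely_certified Act (\<Union>k\<in>K. U k)"
  unfolding finitely_certified_def
proof (intro conjI ballI)
  fix s assume "s \<in> (\<Union>k\<in>K. U k)"
  then obtain k where k: "k \<in> K" "s \<in> U k" by blast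
  then obtain n where "cylinder Act (map s [0..<n]) \<subseteq> U k"
    using assms[OF k(1)] unfolding finitely_certified_def by blast
  then show "\<exists>n. cylinder Act (map s [0..<n]) \<subseteq> (\<Union>k\<in>K. U k)" using k(1) by blast
qed (use assms in \<open>auto simp: finitely_certified_def\<close>)

lemma finitely_certified_Int:
  assumes "finitely_certified Act U" "finitely_certified Act V"
  shows "finitely_certified Act (U \<inter> V)"
  unfolding finitely_certified_def
proof (intro conjI ballI)
  fix s assume "s \<in> U \<inter> V"
  then obtain m n where "cylinder Act (map s [0..<m]) \<subseteq> U" "cylinder Act (map s [0..<n]) \<subseteq> V"
    using assms unfolding finitely_certified_def by (meson IntE)
  then have "cylinder Act (map s [0..<max m n]) \<subseteq> U \<inter> V"
    using cylinder_map_antimono[of m "max m n" Act s] cylinder_map_antimono[of n "max m n" Act s] by auto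
  then show "\<exists>n. cylinder Act (map s [0..<n]) \<subseteq> U \<inter> V" by blast
qed (use assms in \<open>auto simp: finitely_certified_def\<close>)

lemma finitely_certified_coordinate:
  "finitely_certified Act {s \<in> plays Act. s n \<in> B}"
  unfolding finitely_certified_def
proof (intro conjI ballI)
  fix s assume "s \<in> {s \<in> plays Act. s n \<in> B}"
  then have "cylinder Act (map s [0..<Suc n]) \<subseteq> {s \<in> plays Act. s n \<in> B}"
    by (auto simp: cylinder_def simp del: upt_Suc)
  then show "\<exists>m. cylinder Act (map s [0..<m]) \<subseteq> {s \<in> plays Act. s n \<in> B}" by blast
qed auto

lemma finitely_certified_plays: "finitely_certified Act (plays Act)"
  by (auto simp: finitely_certified_def cylinder_def)

text \<open>
  Each play of \<open>U\<close> is cut at the first moment at which its history guarantees membership in \<open>U\<close>.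
  No such minimal history extends another one, so their cylinders are disjoint.
\<close>

lemma finitely_certified_minimal_histories:
  assumes U: "finitely_certified Act U"
  shows "\<exists>M\<subseteq>lists (profiles Act).
    disjoint_family_on (cylinder Act) M \<and> U = (\<Union>l\<in>M. cylinder Act l)"
proof -
  define M where "M = {l \<in> lists (profiles Act). cylinder Act l \<subseteq> U \<and>
    (\<forall>k<length l. \<not> cylinder Act (take k l) \<subseteq> U)}"
  have le: "length l \<le> length l'" if "l \<in> M" "l' \<in> M" "s \<in> cylinder Act l" "s \<in> cylinder Act l'"
    for l l' s
  proof (rule ccontr)
    assume less: "\<not> length l \<le> length l'"
    have "take (length l') l = take (length l') (map s [0..<length l])"
      using that by (simp add: mem_cylinder_iff)
    also have "\<dots> = map s [0..<length l']" using less by (simp add: take_map)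
    also have "\<dots> = l'" using that by (simp add: mem_cylinder_iff)
    finally have "cylinder Act (take (length l') l) \<subseteq> U" using that by (simp add: M_def)
    then show False using that less by (auto simp: M_def)
  qed
  have "l = l'" if "l \<in> M" "l' \<in> M" "s \<in> cylinder Act l" "s \<in> cylinder Act l'" for l l' s
    using le[OF that] le[OF that(2,1,4,3)] that by (metis le_antisym mem_cylinder_iff)
  then have "disjoint_family_on (cylinder Act) M" by (auto simp: disjoint_family_on_def)
  moreover have "U = (\<Union>l\<in>M. cylinder Act l)"
  proof (intro equalityI subsetI)
    fix s assume s: "s \<in> U"
    then have sp: "s \<in> plays Act" using U by (auto simp: finitely_certified_def)
    define n where "n = (LEAST n. cylinder Act (map s [0..<n]) \<subseteq> U)"
    have ex: "\<exists>n. cylinder Act (map s [0..<n]) \<subseteq> U" using U s by (auto simp: finitely_certified_def)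
    have "cylinder Act (map s [0..<n]) \<subseteq> U" unfolding n_def by (rule LeastI_ex[OF ex])
    moreover have "\<not> cylinder Act (take k (map s [0..<n])) \<subseteq> U" if "k < n" for k
      using not_less_Least[of k "\<lambda>n. cylinder Act (map s [0..<n]) \<subseteq> U"] that
      by (simp add: n_def take_map)
    moreover have "map s [0..<n] \<in> lists (profiles Act)" using sp by (auto simp: plays_def PiE_iff)
    ultimately have "map s [0..<n] \<in> M" by (auto simp: M_def)
    then show "s \<in> (\<Union>l\<in>M. cylinder Act l)" using mem_cylinder_map[OF sp, of n] by blast
  qed (auto simp: M_def)
  moreover have "M \<subseteq> lists (profiles Act)" by (auto simp: M_def)
  ultimately show ?thesis by blast
qed

lemma sets_finitely_certified:
  fixes Act :: "'i::finite \<Rightarrow> 'a set"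
  assumes "\<And>i. finite (Act i)" "finitely_certified Act U"
  shows "U \<in> sets (play_borel Act)"
proof -
  obtain M where M: "M \<subseteq> lists (profiles Act)" "U = (\<Union>l\<in>M. cylinder Act l)"
    using finitely_certified_minimal_histories[OF assms(2)] by (elim exE conjE) (rule that)
  show ?thesis unfolding M(2) by (rule sets_Union_cylinder[where Act = Act, OF assms(1) M(1)])
qed

text \<open>
  Approximating a set and its complement simultaneously makes the property symmetric under
  complements; this is what lets it pass through the generation of the \<open>\<sigma>\<close>-algebra. For
  a countable union the outer sets are united, with errors forming a geometric series, but only
  finitely many of the sets around the complements can be intersected; continuity of the measure
  makes the remaining ones negligible.
\<close>

lemma finitely_certified_regular:
  fixes Act :: "'i::finite \<Rightarrow> 'a set"
  assumes fin: "\<And>i. finite (Act i)"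
    and "finite_measure \<mu>" and sets: "sets \<mu> = sets (play_borel Act)"
    and B: "B \<in> sets (play_borel Act)" and "0 < e"
  shows "\<exists>U V. finitely_certified Act U \<and> finitely_certified Act V \<and>
    B \<subseteq> U \<and> plays Act - B \<subseteq> V \<and> measure \<mu> (U \<inter> V) < e"
proof -
  interpret finite_measure \<mu> by fact
  note meas = sets_finitely_certified[where Act = Act, OF fin, folded sets]
  have "B \<in> sigma_sets (plays Act) {{f \<in> plays Act. f n \<in> A} |n A. A \<subseteq> profiles Act}"
    using B unfolding sets_PiM_profiles[where Act = Act, OF fin, symmetric] sets_PiM_single plays_def by simp
  then show ?thesis using \<open>0 < e\<close>
  proof (induction B arbitrary: e rule: sigma_sets.induct)
    case (Basic B)
    then obtain n A where B: "B = {f \<in> plays Act. f n \<in> A}" by auto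
    have "plays Act - B = {f \<in> plays Act. f n \<in> - A}" by (auto simp: B)
    then have "finitely_certified Act (plays Act - B)"
      by (simp only: finitely_certified_coordinate)
    moreover have "finitely_certified Act B" unfolding B by (rule finitely_certified_coordinate)
    moreover have "B \<inter> (plays Act - B) = {}" by blast
    ultimately have "finitely_certified Act B \<and> finitely_certified Act (plays Act - B) \<and>
        B \<subseteq> B \<and> plays Act - B \<subseteq> plays Act - B \<and> measure \<mu> (B \<inter> (plays Act - B)) < e"
      using Basic.prems by simp
    then show ?case by blast
  next
    case Empty
    have "finitely_certified Act {}" by (simp add: finitely_certified_def)
    moreover have "measure \<mu> ({} \<inter> plays Act) < e" using Empty.prems by simp
    moreover have "plays Act - {} \<subseteq> plays Act" by (rule Diff_subset)
    ultimately show ?case using finitely_certified_plays[of Act] by blast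
  next
    case (Compl B)
    from Compl.IH[OF Compl.prems] obtain U V where UV: "finitely_certified Act U" "finitely_certified Act V"
      "B \<subseteq> U" "plays Act - B \<subseteq> V" "measure \<mu> (U \<inter> V) < e" by blast
    have "plays Act - (plays Act - B) \<subseteq> U" using UV(3) by blast
    moreover have "measure \<mu> (V \<inter> U) < e" using UV(5) by (simp only: Int_commute)
    ultimately show ?case using UV(1,2,4) by blast
  next
    case (Union B)
    \<comment> \<open>The errors \<open>d k\<close> add up to \<open>e / 2\<close>; the other half of \<open>e\<close> pays for truncating the union.\<close>
    define d where "d k = e / 2 * (1/2) ^ Suc k" for k
    have d: "0 < d k" for k using Union.prems by (simp add: d_def)
    obtain U V where UV: "\<And>k. finitely_certified Act (U k)" "\<And>k. finitely_certified Act (V k)"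
      "\<And>k. B k \<subseteq> U k" "\<And>k. plays Act - B k \<subseteq> V k" "\<And>k. measure \<mu> (U k \<inter> V k) < d k"
    proof -
      have "\<forall>k. \<exists>U V. finitely_certified Act U \<and> finitely_certified Act V \<and> B k \<subseteq> U \<and>
          plays Act - B k \<subseteq> V \<and> measure \<mu> (U \<inter> V) < d k"
        using Union.IH[OF d] by blast
      then show ?thesis using that by metis
    qed
    define W where "W = (\<Union>k. U k)"
    have W: "finitely_certified Act W" unfolding W_def by (intro finitely_certified_UN UV(1))
    have "(\<lambda>K. measure \<mu> (\<Union>k\<le>K. U k)) \<longlonglongrightarrow> measure \<mu> (\<Union>K. \<Union>k\<le>K. U k)"
      using meas[OF UV(1)] by (intro finite_Lim_measure_incseq monoI UN_mono) auto
    also have "(\<Union>K. \<Union>k\<le>K. U k) = W" by (auto simp: W_def)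
    finally have "\<forall>\<^sub>F K in sequentially. measure \<mu> W - e / 2 < measure \<mu> (\<Union>k\<le>K. U k)"
      using Union.prems by (intro order_tendstoD) auto
    then obtain K where K: "measure \<mu> W - e / 2 < measure \<mu> (\<Union>k\<le>K. U k)"
      by (auto simp: eventually_sequentially)
    define V' where "V' = (\<lambda>n. plays Act \<inter> (\<Inter>k\<le>n. V k))"
    have V': "finitely_certified Act (V' n)" for n
    proof (induction n)
      case 0
      show ?case using finitely_certified_Int[OF finitely_certified_plays UV(2)[of 0]] by (simp add: V'_def)
    next
      case (Suc n)
      have "V' (Suc n) = V' n \<inter> V (Suc n)" by (auto simp: V'_def atMost_Suc)
      then show ?case using finitely_certified_Int[OF Suc UV(2)[of "Suc n"]] by simp
    qed
    have UK: "(\<Union>k\<le>K. U k) \<in> sets \<mu>" "W \<in> sets \<mu>" using meas[OF UV(1)] meas[OF W] by auto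
    have "W \<inter> V' K \<subseteq> (W - (\<Union>k\<le>K. U k)) \<union> (\<Union>k\<le>K. U k \<inter> V k)"
      by (auto simp: V'_def)
    then have "measure \<mu> (W \<inter> V' K) \<le> measure \<mu> ((W - (\<Union>k\<le>K. U k)) \<union> (\<Union>k\<le>K. U k \<inter> V k))"
      using UK meas[OF UV(1)] meas[OF UV(2)] meas[OF V'] by (intro finite_measure_mono) auto
    also have "\<dots> \<le> measure \<mu> (W - (\<Union>k\<le>K. U k)) + measure \<mu> (\<Union>k\<le>K. U k \<inter> V k)"
      using UK meas[OF UV(1)] meas[OF UV(2)] meas[OF V'] by (intro measure_Un_le) auto
    also have "measure \<mu> (W - (\<Union>k\<le>K. U k)) = measure \<mu> W - measure \<mu> (\<Union>k\<le>K. U k)"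
      using UK by (intro finite_measure_Diff) (auto simp: W_def)
    also have "\<dots> < e / 2" using K by simp
    also have "measure \<mu> (\<Union>k\<le>K. U k \<inter> V k) \<le> (\<Sum>k\<le>K. measure \<mu> (U k \<inter> V k))"
      using meas[OF UV(1)] meas[OF UV(2)] by (intro measure_UNION_le) auto
    also have "\<dots> \<le> (\<Sum>k\<le>K. d k)" using UV(5) by (intro sum_mono less_imp_le)
    also have "\<dots> \<le> (\<Sum>k. d k)"
      using d by (intro sum_le_suminf) (auto simp: d_def less_imp_le intro!: summable_mult)
    also have "(\<Sum>k. d k) = e / 2"
      using power_half_series[THEN sums_mult, of "e / 2"] by (simp add: d_def sums_iff)
    finally have "measure \<mu> (W \<inter> V' K) < e" by simp
    moreover have "(\<Union>k. B k) \<subseteq> W" "plays Act - (\<Union>k. B k) \<subseteq> V' K"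
      using UV(3) UV(4) unfolding W_def V'_def by blast+
    ultimately show ?case using W V'[of K] by blast
  qed
qed

lemma cover_by_disjoint_cylinders:
  fixes Act :: "'i::finite \<Rightarrow> 'a set"
  assumes fin: "\<And>i. finite (Act i)"
    and "finite_measure \<mu>" and sets: "sets \<mu> = sets (play_borel Act)"
    and B: "B \<in> sets (play_borel Act)" and less: "measure \<mu> B < c"
  shows "\<exists>M\<subseteq>lists (profiles Act). disjoint_family_on (cylinder Act) M \<and>
    B \<subseteq> (\<Union>l\<in>M. cylinder Act l) \<and> measure \<mu> (\<Union>l\<in>M. cylinder Act l) < c"
proof -
  interpret finite_measure \<mu> by fact
  from less have "0 < c - measure \<mu> B" by simp
  from finitely_certified_regular[where Act = Act, OF fin assms(2) sets B this] obtain U V where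
    UV: "finitely_certified Act U" "finitely_certified Act V" "B \<subseteq> U" "plays Act - B \<subseteq> V"
    "measure \<mu> (U \<inter> V) < c - measure \<mu> B" by blast
  note meas = sets_finitely_certified[where Act = Act, OF fin, folded sets]
  have "U \<subseteq> B \<union> (U \<inter> V)" using UV(1,4) by (auto simp: finitely_certified_def)
  then have "measure \<mu> U \<le> measure \<mu> (B \<union> (U \<inter> V))"
    using meas[OF UV(1)] meas[OF UV(2)] B by (intro finite_measure_mono) (auto simp: sets)
  also have "\<dots> \<le> measure \<mu> B + measure \<mu> (U \<inter> V)"
    using meas[OF UV(1)] meas[OF UV(2)] B by (intro measure_Un_le) (auto simp: sets)
  finally have "measure \<mu> U < c" using UV(5) by simp
  then show ?thesis using finitely_certified_minimal_histories[OF UV(1)] UV(3) by metis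
qed

section \<open>Deviations from a strategy profile\<close>

lemma measure_cylinder:
  fixes Act :: "'i::finite \<Rightarrow> 'a set"
  assumes fin: "\<And>i. finite (Act i)" and nonempty: "\<And>i. Act i \<noteq> {}"
    and \<sigma>: "\<And>i. \<sigma> i \<in> behavior_strategies Act i" and l: "l \<in> lists (profiles Act)"
  shows "measure (play_measure Act \<sigma>) (cylinder Act l)
    = (\<Prod>k<length l. \<Prod>i\<in>UNIV. pmf (\<sigma> i (take k l)) ((l ! k) i))"
proof -
  have "profiles Act \<noteq> {}" using nonempty by (simp add: profiles_def PiE_eq_empty_iff)
  then obtain a where a: "a \<in> profiles Act" by blast
  define t where "t k = (if k < length l then l ! k else a)" for k
  have t: "t \<in> plays Act" using a l by (auto simp: t_def plays_def)
  have take: "map t [0..<k] = take k l" if "k < length l" for k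
    using that by (intro nth_equalityI) (auto simp: t_def)
  have "cylinder Act l = {s \<in> plays Act. \<forall>k<length l. s k = t k}"
    by (auto simp: cylinder_def t_def)
  then have "measure (play_measure Act \<sigma>) (cylinder Act l)
      = (\<Prod>k<length l. \<Prod>i\<in>UNIV. pmf (\<sigma> i (map t [0..<k])) (t k i))"
    using measure_play_measure_cylinder[of Act \<sigma> t, OF fin \<sigma> t] by simp
  also have "\<dots> = (\<Prod>k<length l. \<Prod>i\<in>UNIV. pmf (\<sigma> i (take k l)) ((l ! k) i))"
    by (intro prod.cong refl) (simp add: take t_def)
  finally show ?thesis .
qed

lemma fun_upd_behavior_strategies:
  assumes "\<And>i. \<sigma> i \<in> behavior_strategies Act i" "\<tau> \<in> behavior_strategies Act i"
  shows "(\<sigma>(i := \<tau>)) j \<in> behavior_strategies Act j"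
  using assms by simp

text \<open>
  Players randomize independently, so along a history the deviation of \<open>i\<close> changes only the factors of
  \<open>i\<close> and that of \<open>j\<close> only those of \<open>j\<close>. Taken together, the two single deviations involve exactly the
  factors of no deviation and of the joint deviation. This identity replaces likelihood ratios, which
  need not exist: a deviator may leave the support of the prescribed strategy.
\<close>

lemma measure_cylinder_two_deviators:
  fixes Act :: "'i::finite \<Rightarrow> 'a set"
  assumes fin: "\<And>i. finite (Act i)" and nonempty: "\<And>i. Act i \<noteq> {}"
    and \<sigma>: "\<And>i. \<sigma> i \<in> behavior_strategies Act i" and l: "l \<in> lists (profiles Act)"
    and \<tau>: "\<tau> \<in> behavior_strategies Act i" and \<rho>: "\<rho> \<in> behavior_strategies Act j"
    and ij: "i \<noteq> j"
  shows "measure (play_measure Act (\<sigma>(i := \<tau>))) (cylinder Act l)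
      * measure (play_measure Act (\<sigma>(j := \<rho>))) (cylinder Act l)
    = measure (play_measure Act \<sigma>) (cylinder Act l)
      * measure (play_measure Act (\<sigma>(i := \<tau>, j := \<rho>))) (cylinder Act l)"
proof -
  note upd = fun_upd_behavior_strategies
  note cyl = measure_cylinder[where Act = Act, OF fin nonempty _ l]
  show ?thesis
    unfolding cyl[of \<sigma>, OF \<sigma>] cyl[of "\<sigma>(i := \<tau>)", OF upd[OF \<sigma> \<tau>]] cyl[of "\<sigma>(j := \<rho>)", OF upd[OF \<sigma> \<rho>]]
      cyl[of "\<sigma>(i := \<tau>, j := \<rho>)", OF upd[OF upd[OF \<sigma> \<tau>] \<rho>]] prod.distrib[symmetric]
    using ij by (intro prod.cong refl) (auto simp: mult.commute)
qed

lemma sum_measure_disjoint_cylinders: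
  fixes Act :: "'i::finite \<Rightarrow> 'a set"
  assumes fin: "\<And>i. finite (Act i)" and "finite_measure \<mu>" and sets: "sets \<mu> = sets (play_borel Act)"
    and H: "finite H" "disjoint_family_on (cylinder Act) H"
  shows "(\<Sum>l\<in>H. measure \<mu> (cylinder Act l)) = measure \<mu> (\<Union>l\<in>H. cylinder Act l)"
proof -
  interpret finite_measure \<mu> by fact
  show ?thesis using H sets_cylinder[where Act = Act, OF fin]
    by (intro finite_measure_finite_Union[symmetric]) (auto simp: sets)
qed

text \<open>
  For finitely many deviations and the histories in \<open>M\<close> of bounded length the claim is an instance of
  \<open>finite_blame\<close>. There are infinitely many strategies and possibly infinitely many histories, but each
  condition "deviation \<open>\<tau>\<close> of \<open>i\<close>, histories of length at most \<open>N\<close>" concerns the blame on finitely many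
  histories, so compactness gives one choice for all of them, and \<open>N\<close> can then tend to infinity.
\<close>

lemma exists_blame_on_histories:
  fixes Act :: "'i::finite \<Rightarrow> 'a set"
  assumes fin: "\<And>i. finite (Act i)" and nonempty: "\<And>i. Act i \<noteq> {}"
    and \<sigma>: "\<And>i. \<sigma> i \<in> behavior_strategies Act i"
    and M: "M \<subseteq> lists (profiles Act)" "disjoint_family_on (cylinder Act) M"
    and less: "measure (play_measure Act \<sigma>) (\<Union>l\<in>M. cylinder Act l) < \<epsilon>"
  shows "\<exists>F :: ('i \<Rightarrow> 'a) list \<Rightarrow> 'i. \<forall>i. \<forall>\<tau>\<in>behavior_strategies Act i.
    measure (play_measure Act (\<sigma>(i := \<tau>))) (\<Union>l\<in>{l\<in>M. F l \<noteq> i}. cylinder Act l) \<le> 2 * sqrt \<epsilon>"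
proof -
  note upd = fun_upd_behavior_strategies
  note fm = prob_space.finite_measure[OF prob_space_play_measure[where Act = Act, OF fin]]
  note sets = sets_play_measure[where Act = Act, OF fin]
  define Q where "Q i \<tau> l = measure (play_measure Act (\<sigma>(i := \<tau>))) (cylinder Act l)" for i \<tau> l
  define S where "S N = {l \<in> M. length l \<le> N}" for N
  have finS: "finite (S N)" for N
    using M(1) finite_lists_length_le[OF finite_profiles[where Act = Act, OF fin]] 
    by (auto simp: S_def lists_eq_set intro: rev_finite_subset)
  have disjS: "disjoint_family_on (cylinder Act) (S N)" for N
    using M(2) by (rule disjoint_family_on_mono[rotated]) (auto simp: S_def)
  define K where "K = (\<lambda>(i, \<tau>, N). {F. (\<Sum>l\<in>{l\<in>S N. F l \<noteq> i}. Q i \<tau> l) \<le> 2 * sqrt \<epsilon>})"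
  define I where "I = {(i, \<tau>, N :: nat). \<tau> \<in> behavior_strategies Act i}"
  have "\<exists>F. \<forall>k\<in>I. F \<in> K k"
  proof (rule finitely_determined_choice[of I "\<lambda>(i, \<tau>, N). S N"])
    fix k F G
    assume k: "F \<in> K k" "\<And>l. l \<in> (case k of (i, \<tau>, N) \<Rightarrow> S N) \<Longrightarrow> G l = F l"
    obtain i \<tau> N where ik: "k = (i, \<tau>, N)" by (cases k)
    have "{l\<in>S N. G l \<noteq> i} = {l\<in>S N. F l \<noteq> i}" using k(2) by (auto simp: ik)
    then show "G \<in> K k" using k(1) by (simp add: K_def ik)
  next
    fix J assume J: "finite J" "J \<subseteq> I"
    \<comment> \<open>A choice that is good up to the largest length bound in \<open>J\<close> is good for the smaller ones.\<close>
    define N where "N = Max (insert 0 ((\<lambda>(i, \<tau>, N). N) ` J))"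
    have N: "n \<le> N" if "(i, \<tau>, n) \<in> J" for i \<tau> n
      unfolding N_def using J(1) that by (intro Max_ge) force+
    define Y where "Y = (\<lambda>(i, \<tau>, N). (i, \<tau>)) ` J"
    have Y: "\<tau> \<in> behavior_strategies Act i" if "(i, \<tau>) \<in> Y" for i \<tau>
      using that J(2) by (auto simp: Y_def I_def)
    have lists: "l \<in> lists (profiles Act)" if "l \<in> S N" for l using that M(1) by (auto simp: S_def)
    have "\<exists>F. \<forall>y\<in>Y. (\<Sum>l\<in>{l\<in>S N. F l \<noteq> fst y}. (\<lambda>(i, \<tau>). Q i \<tau>) y l) \<le> 2 * sqrt \<epsilon>"
    proof (rule finite_blame[where p = "\<lambda>l. measure (play_measure Act \<sigma>) (cylinder Act l)" and
          r = "\<lambda>(i, \<tau>) (j, \<rho>) l. measure (play_measure Act (\<sigma>(i := \<tau>, j := \<rho>))) (cylinder Act l)"])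
      show "finite Y" using J(1) by (simp add: Y_def)
      show "finite (S N)" by (rule finS)
      have "(\<Sum>l\<in>S N. measure (play_measure Act \<sigma>) (cylinder Act l))
          = measure (play_measure Act \<sigma>) (\<Union>l\<in>S N. cylinder Act l)"
        by (rule sum_measure_disjoint_cylinders[where Act = Act, OF fin fm[OF \<sigma>] sets[OF \<sigma>] finS disjS])
      also have "\<dots> \<le> measure (play_measure Act \<sigma>) (\<Union>l\<in>M. cylinder Act l)"
        using sets_Union_cylinder[where Act = Act, OF fin M(1)] sets[OF \<sigma>]
        by (intro finite_measure.finite_measure_mono[OF fm[OF \<sigma>]]) (auto simp: S_def)
      also note less
      finally show "(\<Sum>l\<in>S N. measure (play_measure Act \<sigma>) (cylinder Act l)) < \<epsilon>" .
    next
      fix y z l assume yz: "y \<in> Y" "z \<in> Y" "l \<in> S N" "fst y \<noteq> fst z"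
      obtain i \<tau> j \<rho> where eq: "y = (i, \<tau>)" "z = (j, \<rho>)" by (cases y, cases z)
      show "(\<lambda>(i, \<tau>). Q i \<tau>) y l * (\<lambda>(i, \<tau>). Q i \<tau>) z l = measure (play_measure Act \<sigma>) (cylinder Act l)
          * (\<lambda>(i, \<tau>) (j, \<rho>) l. measure (play_measure Act (\<sigma>(i := \<tau>, j := \<rho>))) (cylinder Act l)) y z l"
        using measure_cylinder_two_deviators[where Act = Act, OF fin nonempty \<sigma> lists[OF yz(3)] Y Y] yz
        by (simp add: eq Q_def)
    next
      fix y z assume yz: "y \<in> Y" "z \<in> Y"
      obtain i \<tau> j \<rho> where eq: "y = (i, \<tau>)" "z = (j, \<rho>)" by (cases y, cases z)
      let ?\<mu> = "play_measure Act (\<sigma>(i := \<tau>, j := \<rho>))"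
      have upd2: "(\<sigma>(i := \<tau>, j := \<rho>)) m \<in> behavior_strategies Act m" for m
        using upd[OF upd[OF \<sigma> Y] Y] yz by (simp only: eq)
      have "(\<Sum>l\<in>S N. measure ?\<mu> (cylinder Act l)) = measure ?\<mu> (\<Union>l\<in>S N. cylinder Act l)"
        by (rule sum_measure_disjoint_cylinders[where Act = Act, OF fin fm[OF upd2] sets[OF upd2] finS disjS])
      also have "\<dots> \<le> 1" by (rule prob_space.prob_le_1[OF prob_space_play_measure[where Act = Act, OF fin upd2]])
      finally show "(\<Sum>l\<in>S N. (\<lambda>(i, \<tau>) (j, \<rho>) l. measure (play_measure Act (\<sigma>(i := \<tau>, j := \<rho>)))
          (cylinder Act l)) y z l) \<le> 1" by (simp add: eq)
    qed (auto simp: Q_def)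
    then obtain F where F: "\<And>i \<tau>. (i, \<tau>) \<in> Y \<Longrightarrow> (\<Sum>l\<in>{l\<in>S N. F l \<noteq> i}. Q i \<tau> l) \<le> 2 * sqrt \<epsilon>"
      by force
    have "F \<in> K (i, \<tau>, n)" if k: "(i, \<tau>, n) \<in> J" for i \<tau> n
    proof -
      have "(\<Sum>l\<in>{l\<in>S n. F l \<noteq> i}. Q i \<tau> l) \<le> (\<Sum>l\<in>{l\<in>S N. F l \<noteq> i}. Q i \<tau> l)"
      proof (rule sum_mono2)
        show "finite {l\<in>S N. F l \<noteq> i}" using finS by simp
        show "{l\<in>S n. F l \<noteq> i} \<subseteq> {l\<in>S N. F l \<noteq> i}" using N[OF k] by (auto simp: S_def)
      qed (simp add: Q_def)
      also have "\<dots> \<le> 2 * sqrt \<epsilon>" using k by (intro F) (force simp: Y_def)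
      finally show ?thesis by (simp add: K_def)
    qed
    then have "F \<in> (\<Inter>k\<in>J. K k)" by auto
    then show "(\<Inter>k\<in>J. K k) \<noteq> {}" by blast
  qed (use finS in auto)
  then obtain F where F: "\<And>i \<tau> N. \<tau> \<in> behavior_strategies Act i \<Longrightarrow>
      (\<Sum>l\<in>{l\<in>S N. F l \<noteq> i}. Q i \<tau> l) \<le> 2 * sqrt \<epsilon>"
    by (force simp: I_def K_def)
  have "measure (play_measure Act (\<sigma>(i := \<tau>))) (\<Union>l\<in>{l\<in>M. F l \<noteq> i}. cylinder Act l) \<le> 2 * sqrt \<epsilon>"
    if \<tau>: "\<tau> \<in> behavior_strategies Act i" for i \<tau>
  proof -
    let ?\<mu> = "play_measure Act (\<sigma>(i := \<tau>))"
    interpret finite_measure ?\<mu> by (rule fm[OF upd[OF \<sigma> \<tau>]])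
    let ?C = "\<lambda>N. \<Union>l\<in>{l\<in>S N. F l \<noteq> i}. cylinder Act l"
    have C: "?C N \<in> sets ?\<mu>" for N
      unfolding sets[OF upd[OF \<sigma> \<tau>]] using M(1) by (intro sets_Union_cylinder[where Act = Act, OF fin]) (auto simp: S_def)
    have "(\<lambda>N. measure ?\<mu> (?C N)) \<longlonglongrightarrow> measure ?\<mu> (\<Union>N. ?C N)"
      using C by (intro finite_Lim_measure_incseq monoI UN_mono) (auto simp: S_def)
    moreover have "measure ?\<mu> (?C N) \<le> 2 * sqrt \<epsilon>" for N
    proof -
      have "measure ?\<mu> (?C N) \<le> (\<Sum>l\<in>{l\<in>S N. F l \<noteq> i}. measure ?\<mu> (cylinder Act l))"
        using finS[of N] sets_cylinder[where Act = Act, OF fin]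
        by (intro measure_UNION_le) (auto simp: sets[OF upd[OF \<sigma> \<tau>]])
      also have "\<dots> \<le> 2 * sqrt \<epsilon>" using F[OF \<tau>] by (simp add: Q_def)
      finally show ?thesis .
    qed
    moreover have "(\<Union>N. ?C N) = (\<Union>l\<in>{l\<in>M. F l \<noteq> i}. cylinder Act l)" by (auto simp: S_def)
    ultimately show ?thesis by (auto intro: LIMSEQ_le_const2)
  qed
  then show ?thesis by blast
qed

text \<open>
  A blame function is needed on the complement of \<open>D\<close> only, but it is built on a larger set: the
  complement is covered by disjoint cylinders of total probability still below \<open>\<epsilon>\<close>, and blame is
  assigned as soon as the play has entered one of them. Such a function is Borel because it is constant
  on each of countably many cylinders.
\<close>

lemma testable_2_sqrt:
  fixes Act :: "'i::finite \<Rightarrow> 'a set"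
  assumes fin: "\<And>i. finite (Act i)" and nonempty: "\<And>i. Act i \<noteq> {}"
    and goal: "goal Act \<sigma> D"
    and less: "measure (play_measure Act \<sigma>) D > 1 - \<epsilon>"
  shows "testable Act \<sigma> D (2 * sqrt \<epsilon>)"
proof -
  have \<sigma>: "\<sigma> i \<in> behavior_strategies Act i" for i using goal by (simp add: goal_def)
  note sets = sets_play_measure[where Act = Act, OF fin]
  interpret P: prob_space "play_measure Act \<sigma>" by (rule prob_space_play_measure[where Act = Act, OF fin \<sigma>])
  have space: "space (play_measure Act \<sigma>) = plays Act"
    using sets_eq_imp_space_eq[OF sets[OF \<sigma>]] by (simp add: space_play_borel)
  have D: "D \<in> sets (play_borel Act)" using goal by (simp add: goal_def)
  then have Dc: "plays Act - D \<in> sets (play_borel Act)"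
    using sets.compl_sets[of D "play_borel Act"] by (simp add: space_play_borel)
  have "measure (play_measure Act \<sigma>) (plays Act - D) < \<epsilon>"
    using P.prob_compl[of D] D less by (simp add: sets[OF \<sigma>] space)
  from cover_by_disjoint_cylinders[where Act = Act, OF fin P.finite_measure_axioms sets[OF \<sigma>] Dc this] obtain M where
    M: "M \<subseteq> lists (profiles Act)" "disjoint_family_on (cylinder Act) M"
    and cover: "plays Act - D \<subseteq> (\<Union>l\<in>M. cylinder Act l)"
    and small: "measure (play_measure Act \<sigma>) (\<Union>l\<in>M. cylinder Act l) < \<epsilon>" by blast
  from exists_blame_on_histories[of Act \<sigma>, OF fin nonempty \<sigma> M small] obtain F :: "('i \<Rightarrow> 'a) list \<Rightarrow> 'i"
    where F: "\<And>i \<tau>. \<tau> \<in> behavior_strategies Act i \<Longrightarrow>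
      measure (play_measure Act (\<sigma>(i := \<tau>))) (\<Union>l\<in>{l\<in>M. F l \<noteq> i}. cylinder Act l) \<le> 2 * sqrt \<epsilon>"
    by blast
  define hist where "hist s = (THE l. l \<in> M \<and> s \<in> cylinder Act l)" for s
  have hist_eq: "hist s = l" if "l \<in> M" "s \<in> cylinder Act l" for s l
    unfolding hist_def using that M(2) by (intro the_equality) (auto simp: disjoint_family_on_def)
  have preimage: "{s \<in> plays Act - D. P (F (hist s))}
      = (plays Act - D) \<inter> (\<Union>l\<in>{l\<in>M. P (F l)}. cylinder Act l)" for P
  proof (intro equalityI subsetI)
    fix s assume s: "s \<in> {s \<in> plays Act - D. P (F (hist s))}"
    then obtain l where "l \<in> M" "s \<in> cylinder Act l" using cover by blast
    then show "s \<in> (plays Act - D) \<inter> (\<Union>l\<in>{l\<in>M. P (F l)}. cylinder Act l)"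
      using s hist_eq by auto
  qed (use hist_eq in auto)
  have "(\<lambda>s. F (hist s)) \<in> blame_functions Act D"
    unfolding blame_functions_def
    unfolding measurable_count_space_eq2[OF finite_class.finite_UNIV]
  proof (intro conjI ballI)
    fix i
    have "(\<lambda>s. F (hist s)) -` {i} \<inter> space (restrict_space (play_borel Act) (plays Act - D))
        = {s \<in> plays Act - D. F (hist s) = i}"
      by (auto simp: space_restrict_space space_play_borel)
    also have "\<dots> \<in> sets (restrict_space (play_borel Act) (plays Act - D))"
      unfolding preimage[of "\<lambda>j. j = i"] using M(1) by (auto simp: sets_restrict_space intro!: sets_Union_cylinder[where Act = Act, OF fin])
    finally show "(\<lambda>s. F (hist s)) -` {i} \<inter> space (restrict_space (play_borel Act) (plays Act - D))
        \<in> sets (restrict_space (play_borel Act) (plays Act - D))" .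
  qed simp
  moreover have "\<forall>i. \<forall>\<tau>\<in>behavior_strategies Act i.
    measure (play_measure Act (\<sigma>(i := \<tau>))) {s \<in> plays Act - D. F (hist s) \<noteq> i} \<le> 2 * sqrt \<epsilon>"
  proof (intro allI ballI)
    fix i \<tau> assume \<tau>: "\<tau> \<in> behavior_strategies Act i"
    note upd = fun_upd_behavior_strategies[of \<sigma>, OF \<sigma> \<tau>]
    interpret Q: prob_space "play_measure Act (\<sigma>(i := \<tau>))" by (rule prob_space_play_measure[where Act = Act, OF fin upd])
    have "measure (play_measure Act (\<sigma>(i := \<tau>))) {s \<in> plays Act - D. F (hist s) \<noteq> i}
        \<le> measure (play_measure Act (\<sigma>(i := \<tau>))) (\<Union>l\<in>{l\<in>M. F l \<noteq> i}. cylinder Act l)"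
      unfolding preimage[of "\<lambda>j. j \<noteq> i"] using M(1)
      by (intro Q.finite_measure_mono) (auto simp: sets[OF upd] intro!: sets_Union_cylinder[where Act = Act, OF fin])
    with F[OF \<tau>] show "measure (play_measure Act (\<sigma>(i := \<tau>)))
        {s \<in> plays Act - D. F (hist s) \<noteq> i} \<le> 2 * sqrt \<epsilon>" by simp
  qed
  ultimately show ?thesis unfolding testable_def by (intro bexI[of _ "\<lambda>s. F (hist s)"])
qed

lemma testable_mono: "testable Act \<sigma> D \<delta> \<Longrightarrow> \<delta> \<le> \<delta>' \<Longrightarrow> testable Act \<sigma> D \<delta>'"
  unfolding testable_def by (meson order_trans)

text \<open>
  With one player the bound is \<open>0\<close>, and it is attained because blaming the only player is never
  wrong. With at least two players the factor under the root is at least \<open>1\<close>.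
\<close>

theorem theorem2p6:
  fixes Act :: "'i::finite \<Rightarrow> 'a set"
    and \<sigma> :: "'i \<Rightarrow> ('i \<Rightarrow> 'a) list \<Rightarrow> 'a pmf"
    and D :: "(nat \<Rightarrow> 'i \<Rightarrow> 'a) set"
    and \<epsilon> :: real
  assumes "\<And>i. finite (Act i)" and "\<And>i. Act i \<noteq> {}"
    and "goal Act \<sigma> D"
    and "measure (play_measure Act \<sigma>) D > 1 - \<epsilon>"
  shows "testable Act \<sigma> D (2 * sqrt ((real CARD('i) - 1) * \<epsilon>))"
proof (cases "CARD('i) = 1")
  case True
  then obtain a :: 'i where a: "UNIV = {a}" by (auto simp: card_1_singleton_iff)
  have "(\<lambda>_. a) \<in> blame_functions Act D" by (simp add: blame_functions_def)
  moreover have "\<forall>i. \<forall>\<tau>\<in>behavior_strategies Act i. measure (play_measure Act (\<sigma>(i := \<tau>)))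
      {s \<in> plays Act - D. a \<noteq> i} \<le> 2 * sqrt ((real CARD('i) - 1) * \<epsilon>)"
  proof (intro allI ballI)
    fix i \<tau>
    have empty: "{s \<in> plays Act - D. a \<noteq> i} = {}" using UNIV_I[of i] unfolding a by blast
    show "measure (play_measure Act (\<sigma>(i := \<tau>))) {s \<in> plays Act - D. a \<noteq> i}
        \<le> 2 * sqrt ((real CARD('i) - 1) * \<epsilon>)"
      unfolding empty True by simp
  qed
  ultimately show ?thesis unfolding testable_def by (intro bexI[of _ "\<lambda>_. a"])
next
  case False
  have "\<sigma> i \<in> behavior_strategies Act i" for i using assms(3) by (simp add: goal_def)
  then interpret prob_space "play_measure Act \<sigma>" by (rule prob_space_play_measure[where Act = Act, OF assms(1)])
  have "0 < \<epsilon>" using assms(4) prob_le_1[of D] by linarith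
  moreover have "0 < CARD('i)" by simp
  then have "1 \<le> real CARD('i) - 1" using False by linarith
  ultimately have "sqrt \<epsilon> \<le> sqrt ((real CARD('i) - 1) * \<epsilon>)" by simp
  then have "2 * sqrt \<epsilon> \<le> 2 * sqrt ((real CARD('i) - 1) * \<epsilon>)" by simp
  then show ?thesis by (rule testable_mono[OF testable_2_sqrt[OF assms]])
qed

end
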